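(* Suppose the orthogonally homogeneous retraction $\mathrm{R}^{\mathcal{H}}$ on $\mathcal{H}^r$ is associated with an isometric vector transport $\mathcal{T}^{\mathcal{H}}$ on $\mathcal{H}^r$, and that they are compatible. Let $(\mathrm{R}^{\mathrm{St}},\mathcal{T}^{\mathrm{St}})$ be the Cayley retraction and its transport on $\mathrm{St}(n,r)$ given by $\mathrm{R}^{\mathrm{St}}_V(\tilde V_p)=\Pi(V,\tilde V_p)V$ and $\mathcal{T}^{\mathrm{St}}_{\tilde V_p}(V_p)=\Pi(V,\tilde V_p)V_p$. For $\big((X,G),(\tilde\eta,\tilde\zeta),(\eta,\zeta)\big)\in\mathrm{T}\mathcal{M}_h\oplus\mathrm{T}\mathcal{M}_h$ with representations $(H,V)$, $(\tilde K,\tilde V_p)$ and $(K,V_p)$, respectively, let $\tilde H=\mathrm{R}^{\mathcal{H}}_H(\tilde K)$ and $\tilde V=\mathrm{R}^{\mathrm{St}}_V(\tilde V_p)$. Then an isometric vector transport $\mathcal{T}_{(\tilde\eta,\tilde\zeta)}(\eta,\zeta)$ on $\mathcal{M}_h$ is given by the tangent vector to $\mathcal{M}_h$ at $(\tilde H\tilde V^\top,I-\tilde V\tilde V^\top)$ represented, with respect to $(\tilde H,\tilde V)$, by $$\bar K=\mathcal{T}^{\mathcal{H}}_{\tilde K}(K)\quad\text{and}\quad\bar V_p=\mathcal{T}^{\mathrm{St}}_{\tilde V_p}\big(V_pM_{H,\omega}^{1/2}\big)M_{\tilde H,\omega}^{-1/2}.$$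
   Context: Let $r\le\min\{m,n\}$ be a positive integer. The map $h:\mathbb{R}^{m\times n}\to\mathbb{R}^q$ is smooth and orthogonally invariant, i.e. $h(XQ)=h(X)$ for all $X$ and all $Q\in\mathcal{O}(n)=\{Q\in\mathbb{R}^{n\times n}:Q^\top Q=I_n\}$. Put $\mathcal{H}=\{X\in\mathbb{R}^{m\times n}:h(X)=0\}$; it is assumed that the differential $\mathrm{D}h_X$ has rank $q$ for all $X\in\mathcal{H}$. Define $\mathcal{H}^r=\{H\in\mathbb{R}^{m\times r}:h([H\ \ 0^{m\times(n-r)}])=0\}$, an embedded submanifold of $\mathbb{R}^{m\times r}$ when nonempty, with the metric inherited from the Frobenius inner product. $\mathrm{Sym}(n)$: symmetric $n\times n$ matrices; $\mathrm{Gr}(n,n-r)=\{G\in\mathrm{Sym}(n):G^2=G,\operatorname{rank}(G)=n-r\}$; $\mathrm{St}(n,r)=\{V\in\mathbb{R}^{n\times r}:V^\top V=I_r\}$. Define $\mathcal{M}_h=\{(X,G)\in\mathbb{R}^{m\times n}\times\mathrm{Gr}(n,n-r):XG=0,\ h(X)=0\}$, an embedded submanifold of $\mathcal{E}=\mathbb{R}^{m\times n}\times\mathrm{Sym}(n)$. A representation of $(X,G)\in\mathcal{M}_h$ is a pair $(H,V)\in\mathcal{H}^r\times\mathrm{St}(n,r)$ with $X=HV^\top$, $G=I-VV^\top$ (one always exists). The tangent space is $\mathrm{T}_{(X,G)}\mathcal{M}_h=\{(KV^\top+HV_p^\top,-V_pV^\top-VV_p^\top):K\in\mathrm{T}_H\mathcal{H}^r,\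 V_p\in\mathbb{R}^{n\times r},\ V^\top V_p=0\}$; $(K,V_p)$ is said to represent (with respect to $(H,V)$) the tangent vector $(KV^\top+HV_p^\top,-V_pV^\top-VV_p^\top)$. For a fixed weight $\omega>0$, $\mathcal{M}_h$ carries the Riemannian metric inherited from $\langle(E_1,Z_1),(E_2,Z_2)\rangle_\omega=\langle E_1,E_2\rangle+\omega\langle Z_1,Z_2\rangle$ on $\mathcal{E}$, $\langle A,B\rangle=\mathrm{tr}(A^\top B)$. $M_{H,\omega}=2\omega I+H^\top H$. For $V\in\mathrm{St}(n,r)$ and $V_p\in\mathrm{T}_V\mathrm{St}(n,r)$, $W(V,V_p)=(I-\tfrac12VV^\top)V_pV^\top-VV_p^\top(I-\tfrac12VV^\top)$ and $\Pi(V,V_p)=(I-\tfrac12W(V,V_p))^{-1}(I+\tfrac12W(V,V_p))$. Retraction: a smooth $\mathrm{R}:\mathrm{T}\mathcal{M}\to\mathcal{M}$ such that for $X\in\mathcal{M}$, $\xi\in\mathrm{T}_X\mathcal{M}$ the curve $\gamma(t)=\mathrm{R}_X(t\xi)$ satisfies $\gamma(0)=X$, $\gamma'(0)=\xi$. Vector transport: with $\mathrm{T}\mathcal{M}\oplus\mathrm{T}\mathcal{M}=\{(X,\tilde\xi,\xi):X\in\mathcal{M},\ \tilde\xi,\xi\in\mathrm{T}_X\mathcal{M}\}$, a smooth map $\mathrm{T}\mathcal{M}\oplus\mathrm{T}\mathcal{M}\to\mathrm{T}\mathcal{M}$, $(X,\tilde\xi,\xi)\mapsto\mathcal{T}_{\tilde\xi}(\xi)$,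 for which there is an associated retraction $\mathrm{R}$ with $\mathcal{T}_{\tilde\xi}(\xi)\in\mathrm{T}_{\mathrm{R}_X(\tilde\xi)}\mathcal{M}$, such that $\mathcal{T}_0(\xi)=\xi$ and $\xi\mapsto\mathcal{T}_{\tilde\xi}(\xi)$ is linear. It is isometric if $\langle\mathcal{T}_{\tilde\xi}(\xi),\mathcal{T}_{\tilde\xi}(\xi)\rangle_{\mathrm{R}_X(\tilde\xi)}=\langle\xi,\xi\rangle_X$ for all $(X,\tilde\xi,\xi)$. Let $\mathcal{M}\subseteq\mathbb{R}^{a\times b}$ be a manifold closed under $X\mapsto XQ$, $Q\in\mathcal{O}(b)$. A retraction is orthogonally homogeneous if $\mathrm{R}_X(\xi)Q=\mathrm{R}_{XQ}(\xi Q)$ for all $Q\in\mathcal{O}(b)$, $(X,\xi)\in\mathrm{T}\mathcal{M}$. A vector transport $\mathcal{T}$ and its associated orthogonally homogeneous retraction are compatible if $\mathcal{T}_{\tilde\xi}(\xi)Q=\mathcal{T}_{\tilde\xi Q}(\xi Q)$ for all $Q\in\mathcal{O}(b)$, $X\in\mathcal{M}$, $\tilde\xi,\xi\in\mathrm{T}_X\mathcal{M}$ (where $\tilde\xi Q,\xi Q\in\mathrm{T}_{XQ}\mathcal{M}$). *)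

theory Defs
  imports "HOL-Analysis.Analysis"
begin

section \<open>Smooth maps\<close>

text \<open>
  On an open subset of a finite-dimensional space, \<open>Ck_on k f U\<close> says that f is of class
  \<open>C\<^sup>k\<close>: the recursion asks all directional derivative functions to be of class
  \<open>C\<^sup>k\<^sup>-\<^sup>1\<close>, which avoids iterated spaces of linear maps as codomains.
\<close>

primrec Ck_on ::
  "nat \<Rightarrow> ('a::real_normed_vector \<Rightarrow> 'b::real_normed_vector) \<Rightarrow> 'a set \<Rightarrow> bool" where
  "Ck_on 0 f U \<longleftrightarrow> continuous_on U f"
| "Ck_on (Suc k) f U \<longleftrightarrow>
     (\<forall>x\<in>U. f differentiable at x) \<and> (\<forall>v. Ck_on k (\<lambda>x. frechet_derivative f (at x) v) U)"

definition smooth_on_open ::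
  "('a::euclidean_space \<Rightarrow> 'b::euclidean_space) \<Rightarrow> 'a set \<Rightarrow> bool" where
  "smooth_on_open f U \<longleftrightarrow> open U \<and> (\<forall>k. Ck_on k f U)"

text \<open>
  Smoothness on an arbitrary subset means local extendability to smooth maps of the ambient
  space; on embedded submanifolds this is the usual notion.
\<close>

definition smooth_map_on ::
  "'a::euclidean_space set \<Rightarrow> ('a \<Rightarrow> 'b::euclidean_space) \<Rightarrow> bool" where
  "smooth_map_on S f \<longleftrightarrow>
     (\<forall>x\<in>S. \<exists>U F. x \<in> U \<and> smooth_on_open F U \<and> (\<forall>y\<in>S \<inter> U. F y = f y))"

section \<open>Tangent vectors, retractions and vector transports\<close>

text \<open>
  All manifolds are embedded submanifolds M of a Euclidean space, represented by their sets of
  points, and tangent vectors are vectors of the ambient space.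
\<close>

definition tangent_space :: "'a::euclidean_space set \<Rightarrow> 'a \<Rightarrow> 'a set" where
  "tangent_space M x =
     {v. \<exists>\<gamma> e. 0 < e \<and> smooth_on_open \<gamma> {-e<..<e::real} \<and> \<gamma> ` {-e<..<e} \<subseteq> M \<and>
            \<gamma> 0 = x \<and> (\<gamma> has_vector_derivative v) (at 0)}"

definition tangent_bundle :: "'a::euclidean_space set \<Rightarrow> ('a \<times> 'a) set" where
  "tangent_bundle M = {(x, \<xi>). x \<in> M \<and> \<xi> \<in> tangent_space M x}"

definition double_tangent_bundle :: "'a::euclidean_space set \<Rightarrow> ('a \<times> 'a \<times> 'a) set" where
  "double_tangent_bundle M =
     {(x, \<xi>', \<xi>). x \<in> M \<and> \<xi>' \<in> tangent_space M x \<and> \<xi> \<in> tangent_space M x}"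

text \<open>
  \<open>R x \<xi>\<close> stands for $R_x(\xi)$ and \<open>T x \<xi>' \<xi>\<close> for
  ${\cal T}_{\xi'}(\xi)$ at the base point x. Only the values on the bundles matter.
\<close>

definition is_retraction :: "'a::euclidean_space set \<Rightarrow> ('a \<Rightarrow> 'a \<Rightarrow> 'a) \<Rightarrow> bool" where
  "is_retraction M R \<longleftrightarrow>
     smooth_map_on (tangent_bundle M) (\<lambda>(x, \<xi>). R x \<xi>) \<and>
     (\<forall>(x, \<xi>)\<in>tangent_bundle M.
        R x \<xi> \<in> M \<and> R x 0 = x \<and> ((\<lambda>t. R x (t *\<^sub>R \<xi>)) has_vector_derivative \<xi>) (at 0))"

definition is_vector_transport ::
  "'a::euclidean_space set \<Rightarrow> ('a \<Rightarrow> 'a \<Rightarrow> 'a) \<Rightarrow> ('a \<Rightarrow> 'a \<Rightarrow> 'a \<Rightarrow> 'a) \<Rightarrow> bool" where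
  "is_vector_transport M R T \<longleftrightarrow>
     is_retraction M R \<and>
     smooth_map_on (double_tangent_bundle M) (\<lambda>(x, \<xi>', \<xi>). (R x \<xi>', T x \<xi>' \<xi>)) \<and>
     (\<forall>(x, \<xi>', \<xi>)\<in>double_tangent_bundle M. T x \<xi>' \<xi> \<in> tangent_space M (R x \<xi>')) \<and>
     (\<forall>(x, \<xi>)\<in>tangent_bundle M. T x 0 \<xi> = \<xi>) \<and>
     (\<forall>(x, \<xi>')\<in>tangent_bundle M. \<forall>\<xi>\<in>tangent_space M x. \<forall>\<eta>\<in>tangent_space M x. \<forall>a b.
        T x \<xi>' (a *\<^sub>R \<xi> + b *\<^sub>R \<eta>) = a *\<^sub>R T x \<xi>' \<xi> + b *\<^sub>R T x \<xi>' \<eta>)"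

text \<open>
  The Riemannian metrics considered here are restrictions of one inner product g of the ambient
  space, the same for all base points.
\<close>

definition is_isometric_vector_transport ::
  "('a \<Rightarrow> 'a \<Rightarrow> real) \<Rightarrow> 'a::euclidean_space set \<Rightarrow> ('a \<Rightarrow> 'a \<Rightarrow> 'a) \<Rightarrow>
   ('a \<Rightarrow> 'a \<Rightarrow> 'a \<Rightarrow> 'a) \<Rightarrow> bool" where
  "is_isometric_vector_transport g M R T \<longleftrightarrow>
     is_vector_transport M R T \<and>
     (\<forall>(x, \<xi>', \<xi>)\<in>double_tangent_bundle M. g (T x \<xi>' \<xi>) (T x \<xi>' \<xi>) = g \<xi> \<xi>)"

definition orth_homogeneous ::
  "(real^'b^'a) set \<Rightarrow> (real^'b^'a \<Rightarrow> real^'b^'a \<Rightarrow> real^'b^'a) \<Rightarrow> bool" where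
  "orth_homogeneous M R \<longleftrightarrow>
     (\<forall>Q. orthogonal_matrix Q \<longrightarrow>
       (\<forall>(X, \<xi>)\<in>tangent_bundle M. R X \<xi> ** Q = R (X ** Q) (\<xi> ** Q)))"

definition compatible_transport ::
  "(real^'b^'a) set \<Rightarrow> (real^'b^'a \<Rightarrow> real^'b^'a \<Rightarrow> real^'b^'a \<Rightarrow> real^'b^'a) \<Rightarrow> bool" where
  "compatible_transport M T \<longleftrightarrow>
     (\<forall>Q. orthogonal_matrix Q \<longrightarrow>
       (\<forall>(X, \<xi>', \<xi>)\<in>double_tangent_bundle M.
          T X \<xi>' \<xi> ** Q = T (X ** Q) (\<xi>' ** Q) (\<xi> ** Q)))"

section \<open>Matrices\<close>

text \<open>The library inner product on matrices is the Frobenius inner product.\<close>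

lemma inner_matrix_eq_trace:
  fixes A B :: "real^'n^'m"
  shows "A \<bullet> B = trace (transpose A ** B)"
proof -
  have "A \<bullet> B = (\<Sum>i\<in>UNIV. \<Sum>j\<in>UNIV. A $ i $ j * B $ i $ j)"
    by (simp add: inner_vec_def)
  also have "\<dots> = (\<Sum>j\<in>UNIV. \<Sum>i\<in>UNIV. A $ i $ j * B $ i $ j)"
    by (rule sum.swap)
  also have "\<dots> = trace (transpose A ** B)"
    by (simp add: trace_def matrix_matrix_mult_def transpose_def)
  finally show ?thesis .
qed

definition pos_semidef :: "real^'r^'r \<Rightarrow> bool" where
  "pos_semidef A \<longleftrightarrow> transpose A = A \<and> (\<forall>x. 0 \<le> x \<bullet> (A *v x))"

definition matrix_sqrt :: "real^'r^'r \<Rightarrow> real^'r^'r" where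
  "matrix_sqrt A = (THE S. pos_semidef S \<and> S ** S = A)"

definition Stiefel :: "(real^'r^'n) set" where
  "Stiefel = {V. transpose V ** V = mat 1}"

text \<open>The Grassmannian, with subspaces of dimension d given by their orthogonal projections.\<close>

definition Grassmann :: "nat \<Rightarrow> (real^'n^'n) set" where
  "Grassmann d = {G. transpose G = G \<and> G ** G = G \<and> rank G = d}"

section \<open>The Cayley retraction and transport on the Stiefel manifold\<close>

definition cayley_W :: "real^'r^'n \<Rightarrow> real^'r^'n \<Rightarrow> real^'n^'n" where
  "cayley_W V Vp =
     (mat 1 - (1/2) *\<^sub>R (V ** transpose V)) ** Vp ** transpose V
     - V ** transpose Vp ** (mat 1 - (1/2) *\<^sub>R (V ** transpose V))"

definition cayley_Pi :: "real^'r^'n \<Rightarrow> real^'r^'n \<Rightarrow> real^'n^'n" where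
  "cayley_Pi V Vp =
     matrix_inv (mat 1 - (1/2) *\<^sub>R cayley_W V Vp) ** (mat 1 + (1/2) *\<^sub>R cayley_W V Vp)"

definition R_St :: "real^'r^'n \<Rightarrow> real^'r^'n \<Rightarrow> real^'r^'n" where
  "R_St V Vp' = cayley_Pi V Vp' ** V"

definition T_St :: "real^'r^'n \<Rightarrow> real^'r^'n \<Rightarrow> real^'r^'n \<Rightarrow> real^'r^'n" where
  "T_St V Vp' Vp = cayley_Pi V Vp' ** Vp"

section \<open>Orthogonally invariant constraints\<close>

definition orth_invariant :: "(real^'n^'m \<Rightarrow> 'b) \<Rightarrow> bool" where
  "orth_invariant h \<longleftrightarrow> (\<forall>X Q. orthogonal_matrix Q \<longrightarrow> h (X ** Q) = h X)"

definition full_rank_on_zeros :: "(real^'n^'m \<Rightarrow> real^'q) \<Rightarrow> bool" where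
  "full_rank_on_zeros h \<longleftrightarrow>
     (\<forall>X. h X = 0 \<longrightarrow> dim (range (frechet_derivative h (at X))) = CARD('q))"

text \<open>
  The block matrix $[H\ \ 0]$. The index types carry no order, so an injection \<open>\<iota>\<close> tells which
  of the n columns are the ``first r'' ones.
\<close>

definition pad_cols :: "('r \<Rightarrow> 'n) \<Rightarrow> real^'r^'m \<Rightarrow> real^'n^'m" where
  "pad_cols \<iota> H = (\<chi> i j. if j \<in> range \<iota> then H $ i $ inv \<iota> j else 0)"

definition H_r :: "(real^'n^'m \<Rightarrow> real^'q) \<Rightarrow> ('r \<Rightarrow> 'n) \<Rightarrow> (real^'r^'m) set" where
  "H_r h \<iota> = {H. h (pad_cols \<iota> H) = 0}"

definition M_h :: "(real^'n^'m \<Rightarrow> real^'q) \<Rightarrow> nat \<Rightarrow> ((real^'n^'m) \<times> (real^'n^'n)) set" where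
  "M_h h r = {(X, G). G \<in> Grassmann (CARD('n) - r) \<and> X ** G = 0 \<and> h X = 0}"

definition metric_M_h ::
  "real \<Rightarrow> (real^'n^'m) \<times> (real^'n^'n) \<Rightarrow> (real^'n^'m) \<times> (real^'n^'n) \<Rightarrow> real" where
  "metric_M_h \<omega> = (\<lambda>(E1, Z1) (E2, Z2). E1 \<bullet> E2 + \<omega> * (Z1 \<bullet> Z2))"

definition M_mat :: "real \<Rightarrow> real^'r^'m \<Rightarrow> real^'r^'r" where
  "M_mat \<omega> H = (2 * \<omega>) *\<^sub>R mat 1 + transpose H ** H"

definition represents_point ::
  "(real^'n^'m \<Rightarrow> real^'q) \<Rightarrow> ('r \<Rightarrow> 'n) \<Rightarrow> real^'r^'m \<Rightarrow> real^'r^'n \<Rightarrow>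
   (real^'n^'m) \<times> (real^'n^'n) \<Rightarrow> bool" where
  "represents_point h \<iota> H V p \<longleftrightarrow>
     H \<in> H_r h \<iota> \<and> V \<in> Stiefel \<and> p = (H ** transpose V, mat 1 - V ** transpose V)"

definition represents_tangent ::
  "(real^'n^'m \<Rightarrow> real^'q) \<Rightarrow> ('r \<Rightarrow> 'n) \<Rightarrow> real^'r^'m \<Rightarrow> real^'r^'n \<Rightarrow>
   real^'r^'m \<Rightarrow> real^'r^'n \<Rightarrow> (real^'n^'m) \<times> (real^'n^'n) \<Rightarrow> bool" where
  "represents_tangent h \<iota> H V K Vp v \<longleftrightarrow>
     K \<in> tangent_space (H_r h \<iota>) H \<and> transpose V ** Vp = 0 \<and>
     v = (K ** transpose V + H ** transpose Vp, - (Vp ** transpose V) - V ** transpose Vp)"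

end

theory Submission
  imports Defs
begin

text \<open>
  A point \<open>(X, G)\<close> of the manifold is determined by an orthonormal frame \<open>V\<close> of the range of the
  projection \<open>1 - G\<close> together with \<open>H = X V\<close>, and a tangent vector \<open>(\<eta>, \<zeta>)\<close> by \<open>K = \<eta> V\<close> and
  \<open>V\<^sub>p = - \<zeta> V\<close> (\<open>tangent_M_h_coords\<close>, with converse \<open>rep_tangent_in_tangent_space\<close>). For a fixed frame
  all claims reduce to the two factors: the given pair acts on \<open>(H, K)\<close> and the Cayley pair on
  \<open>(V, V\<^sub>p)\<close>. In these coordinates the squared length of a tangent vector is
  \<open>\<parallel>K\<parallel>\<^sup>2 + \<parallel>V\<^sub>p S\<parallel>\<^sup>2\<close> with \<open>S\<close> the square root of \<open>M_mat \<omega> H\<close> (\<open>metric_rep_tangent\<close>). The factors \<open>S\<close> and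
  \<open>S'\<^sup>-\<^sup>1\<close> in the transport are there to compensate for the change of this weight: \<open>V\<^sub>p S\<close> is
  multiplied by the orthogonal Cayley matrix, while \<open>K\<close> is moved by an isometric transport.

  Two points need care. First, the frame is only determined up to an orthogonal matrix \<open>Q\<close>, and
  passing from \<open>V\<close> to \<open>V Q\<close> multiplies all representing matrices by \<open>Q\<close>. Homogeneity and compatibility say
  that the given pair respects this, and the Cayley pair and the square root of \<open>M_mat \<omega> H\<close> respect it as
  well, so that the result does not depend on the frame (\<open>frame_retraction_indep\<close>,
  \<open>frame_transport_indep\<close>). Secondly, a frame cannot in general be chosen continuously on the
  whole manifold. Smoothness is a local property, however, and near a base point the
  polar orthonormalization of a fixed frame \<open>V\<^sub>0\<close> depends smoothly on \<open>G\<close>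
  (\<open>smooth_map_on_polar_frame\<close>); by frame independence the transport may be computed with it.

  The same polar frame lifts a curve in the manifold to a pair of curves \<open>(H(t), V(t))\<close>, which
  yields the description of the tangent spaces. Both uses rest on the smoothness of matrix inversion
  and of the square root of positive definite matrices. An inverse solves a linear equation, and
  the derivative of the root solves a Lyapunov equation; \<open>Ck_on_linear_solution\<close> is the common source of their regularity.
\<close>


section \<open>Calculus of smooth maps\<close>

lemma Ck_on_SucD:
  assumes "Ck_on (Suc k) f U" shows "Ck_on k f U"
  using assms
proof (induction k arbitrary: f)
  case 0
  then have "f differentiable_on U"
    by (auto simp: differentiable_on_def intro: differentiable_at_withinI)
  then show ?case
    by (simp add: differentiable_imp_continuous_on)
next
  case (Suc k)
  then show ?case by auto
qed

lemma Ck_on_imp_continuous_on: "Ck_on k f U \<Longrightarrow> continuous_on U f"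
proof (induction k)
  case (Suc k)
  then show ?case using Ck_on_SucD by blast
qed simp

lemma Ck_on_subset: "Ck_on k f U \<Longrightarrow> W \<subseteq> U \<Longrightarrow> Ck_on k f W"
  by (induction k arbitrary: f) (auto intro: continuous_on_subset)

lemma Ck_on_cong:
  assumes "open U" "\<And>x. x \<in> U \<Longrightarrow> f x = g x" "Ck_on k f U"
  shows "Ck_on k g U"
  using assms(2,3)
proof (induction k arbitrary: f g)
  case 0
  then show ?case using continuous_on_cong[of U U f g] by simp
next
  case (Suc k)
  have D: "(g has_derivative frechet_derivative f (at x)) (at x)" if "x \<in> U" for x
  proof (rule has_derivative_transform_within_open[OF _ \<open>open U\<close> that Suc.prems(1)])
    show "(f has_derivative frechet_derivative f (at x)) (at x)"
      using Suc.prems(2) that by (simp add: frechet_derivative_works[symmetric])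
  qed
  have eq: "frechet_derivative g (at x) = frechet_derivative f (at x)" if "x \<in> U" for x
    using D[OF that] frechet_derivative_at by metis
  have "Ck_on k (\<lambda>x. frechet_derivative g (at x) v) U" for v
    by (rule Suc.IH[of "\<lambda>x. frechet_derivative f (at x) v"]) (use eq Suc.prems(2) in auto)
  moreover have "g differentiable at x" if "x \<in> U" for x
    using D[OF that] unfolding differentiable_def by blast
  ultimately show ?case
    by simp
qed

lemma Ck_on_SucI:
  assumes "open U" "\<And>x. x \<in> U \<Longrightarrow> (f has_derivative f' x) (at x)"
    "\<And>v. Ck_on k (\<lambda>x. f' x v) U"
  shows "Ck_on (Suc k) f U"
proof -
  have eq: "frechet_derivative f (at x) = f' x" if "x \<in> U" for x
    using assms(2)[OF that] frechet_derivative_at by metis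
  have "Ck_on k (\<lambda>x. frechet_derivative f (at x) v) U" for v
    by (rule Ck_on_cong[OF assms(1) _ assms(3)[of v]]) (simp add: eq)
  moreover have "f differentiable at x" if "x \<in> U" for x
    using assms(2)[OF that] unfolding differentiable_def by blast
  ultimately show ?thesis by simp
qed

lemma Ck_on_has_derivative:
  "Ck_on (Suc k) f U \<Longrightarrow> x \<in> U \<Longrightarrow> (f has_derivative frechet_derivative f (at x)) (at x)"
  by (simp add: frechet_derivative_works[symmetric])

text \<open>Because of this, a map on an open set that agrees near every point with some smooth map is itself
  smooth, so that on open sets \<open>smooth_map_on\<close> and \<open>smooth_on_open\<close> express the same property.\<close>

lemma Ck_on_local:
  assumes "\<And>x. x \<in> U \<Longrightarrow> \<exists>W. open W \<and> x \<in> W \<and> Ck_on k f W"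
  shows "Ck_on k f U"
  using assms
proof (induction k arbitrary: f)
  case 0
  have "continuous (at x) f" if x: "x \<in> U" for x
  proof -
    obtain W where "open W" "x \<in> W" "continuous_on W f"
      using "0.prems"[OF x] by auto
    then show ?thesis
      using continuous_on_eq_continuous_at by blast
  qed
  then show ?case by (simp add: continuous_at_imp_continuous_on)
next
  case (Suc k)
  have "Ck_on k (\<lambda>x. frechet_derivative f (at x) v) U" for v
  proof (rule Suc.IH)
    fix x assume "x \<in> U"
    then obtain W where "open W" "x \<in> W" "Ck_on (Suc k) f W"
      using Suc.prems by blast
    then show "\<exists>W. open W \<and> x \<in> W \<and> Ck_on k (\<lambda>x. frechet_derivative f (at x) v) W"
      by (intro exI[of _ W]) simp
  qed
  moreover have "f differentiable at x" if "x \<in> U" for x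
    using Suc.prems[OF that] by auto
  ultimately show ?case by simp
qed

lemma Ck_on_const: "Ck_on k (\<lambda>x. c) U"
  by (induction k arbitrary: c) auto

lemma Ck_on_add:
  assumes "open U" "Ck_on k f U" "Ck_on k g U"
  shows "Ck_on k (\<lambda>x. f x + g x) U"
  using assms(2,3)
proof (induction k arbitrary: f g)
  case 0
  then show ?case by (simp add: continuous_on_add)
next
  case (Suc k)
  note D = Ck_on_has_derivative[OF Suc.prems(1)] Ck_on_has_derivative[OF Suc.prems(2)]
  show ?case
    by (rule Ck_on_SucI[OF \<open>open U\<close> has_derivative_add[OF D]])
      (use Suc in auto)
qed

lemma Ck_on_sum:
  assumes "open U" "finite I" "\<And>i. i \<in> I \<Longrightarrow> Ck_on k (f i) U"
  shows "Ck_on k (\<lambda>x. \<Sum>i\<in>I. f i x) U"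
  using assms(2,3) by (induction I) (auto simp: Ck_on_const intro: Ck_on_add[OF assms(1)])

lemma Ck_on_linear:
  assumes "bounded_linear L" "open U" "Ck_on k f U"
  shows "Ck_on k (\<lambda>x. L (f x)) U"
  using assms(3)
proof (induction k arbitrary: f)
  case 0
  then show ?case
    using assms(1) by (simp add: bounded_linear.continuous_on)
next
  case (Suc k)
  show ?case
    by (rule Ck_on_SucI[OF \<open>open U\<close> bounded_linear.has_derivative[OF assms(1)
          Ck_on_has_derivative[OF Suc.prems]]])
      (use Suc in auto)
qed

lemma Ck_on_bilinear:
  assumes "bounded_bilinear b" "open U" "Ck_on k f U" "Ck_on k g U"
  shows "Ck_on k (\<lambda>x. b (f x) (g x)) U"
  using assms(3,4)
proof (induction k arbitrary: f g)
  case 0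
  then show ?case
    using assms(1) by (simp add: bounded_bilinear.continuous_on)
next
  case (Suc k)
  note D = bounded_bilinear.FDERIV[OF assms(1) Ck_on_has_derivative[OF Suc.prems(1)]
      Ck_on_has_derivative[OF Suc.prems(2)]]
  show ?case
    by (rule Ck_on_SucI[OF \<open>open U\<close> D])
      (use Suc Suc.prems[THEN Ck_on_SucD] in \<open>auto intro!: Ck_on_add[OF \<open>open U\<close>]\<close>)
qed

text \<open>The chain rule expresses a directional derivative of a composition as a finite sum,
  over a basis of the intermediate space, of products of directional derivatives; this is what
  lets the induction on the order of differentiability go through.\<close>

lemma Ck_on_compose:
  fixes f :: "'a::real_normed_vector \<Rightarrow> 'b::euclidean_space" and g :: "'b \<Rightarrow> 'c::real_normed_vector"
  assumes "open U" "open V" "f ` U \<subseteq> V" "Ck_on k f U" "Ck_on k g V"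
  shows "Ck_on k (\<lambda>x. g (f x)) U"
  using assms(4,5)
proof (induction k arbitrary: g)
  case 0
  then show ?case using assms(3)
    by (auto intro: continuous_on_compose2)
next
  case (Suc k)
  let ?g' = "\<lambda>y. frechet_derivative g (at y)"
  let ?f' = "\<lambda>x. frechet_derivative f (at x)"
  have g': "(g has_derivative ?g' (f x)) (at (f x))" if "x \<in> U" for x
    using Ck_on_has_derivative[OF Suc.prems(2)] assms(3) that by auto
  have D: "((\<lambda>x. g (f x)) has_derivative (\<lambda>v. \<Sum>b\<in>Basis. (?f' x v \<bullet> b) *\<^sub>R ?g' (f x) b)) (at x)"
    if "x \<in> U" for x
  proof -
    have g'_basis: "?g' (f x) w = (\<Sum>b\<in>Basis. (w \<bullet> b) *\<^sub>R ?g' (f x) b)" for w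
      using linear_sum[OF has_derivative_linear[OF g'[OF that]], of "\<lambda>b. (w \<bullet> b) *\<^sub>R b" Basis]
      by (simp add: euclidean_representation linear_scale[OF has_derivative_linear[OF g'[OF that]]])
    have "?g' (f x) \<circ> ?f' x = (\<lambda>v. \<Sum>b\<in>Basis. (?f' x v \<bullet> b) *\<^sub>R ?g' (f x) b)"
      unfolding o_def by (rule ext, rule g'_basis)
    then show ?thesis
      using diff_chain_at[OF Ck_on_has_derivative[OF Suc.prems(1) that] g'[OF that]]
      by (simp add: o_def)
  qed
  show ?case
  proof (rule Ck_on_SucI[OF \<open>open U\<close> D])
    fix v
    have "Ck_on k (\<lambda>x. ?f' x v) U" using Suc.prems by auto
    moreover have "Ck_on k (\<lambda>x. ?g' (f x) b) U" for b
      using Suc.IH[of "\<lambda>y. ?g' y b"] Ck_on_SucD[OF Suc.prems(1)] Suc.prems(2) by auto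
    ultimately show "Ck_on k (\<lambda>x. \<Sum>b\<in>Basis. (?f' x v \<bullet> b) *\<^sub>R ?g' (f x) b) U"
      by (intro Ck_on_sum Ck_on_bilinear[OF bounded_bilinear_scaleR] \<open>open U\<close>
          Ck_on_linear[OF bounded_linear_inner_left] finite_Basis)
  qed auto
qed

lemma smooth_on_open_subset:
  "smooth_on_open f U \<Longrightarrow> open W \<Longrightarrow> W \<subseteq> U \<Longrightarrow> smooth_on_open f W"
  by (auto simp: smooth_on_open_def intro: Ck_on_subset)

lemma smooth_on_open_compose:
  assumes "smooth_on_open f U" "smooth_on_open g V" "f ` U \<subseteq> V"
  shows "smooth_on_open (\<lambda>x. g (f x)) U"
  using assms by (auto simp: smooth_on_open_def intro: Ck_on_compose)

lemma smooth_on_open_linear: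
  assumes "bounded_linear L" "smooth_on_open f U"
  shows "smooth_on_open (\<lambda>x. L (f x)) U"
  using assms by (auto simp: smooth_on_open_def intro: Ck_on_linear)

lemma smooth_on_open_bilinear:
  assumes "bounded_bilinear b" "smooth_on_open f U" "smooth_on_open g U"
  shows "smooth_on_open (\<lambda>x. b (f x) (g x)) U"
  using assms by (auto simp: smooth_on_open_def intro: Ck_on_bilinear)

lemma smooth_on_open_add:
  assumes "smooth_on_open f U" "smooth_on_open g U"
  shows "smooth_on_open (\<lambda>x. f x + g x) U"
  using assms by (auto simp: smooth_on_open_def intro: Ck_on_add)

lemma smooth_on_open_Pair:
  assumes "smooth_on_open f U" "smooth_on_open g U"
  shows "smooth_on_open (\<lambda>x. (f x, g x)) U"
proof -
  have "smooth_on_open (\<lambda>x. (f x, 0) + (0, g x)) U"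
    by (intro smooth_on_open_add smooth_on_open_linear[of "\<lambda>y. (y, 0)"]
        smooth_on_open_linear[of "\<lambda>y. (0, y)"] assms)
      (auto intro!: bounded_linear_Pair bounded_linear_ident bounded_linear_zero)
  then show ?thesis by simp
qed

lemma smooth_on_open_id: "open U \<Longrightarrow> smooth_on_open (\<lambda>x. x) U"
proof -
  have "Ck_on k (\<lambda>x. x) (U :: 'a set)" for k
    by (cases k) (auto simp: Ck_on_const continuous_on_id)
  then show "open U \<Longrightarrow> ?thesis" by (simp add: smooth_on_open_def)
qed

lemma smooth_on_open_imp_continuous_on: "smooth_on_open f U \<Longrightarrow> continuous_on U f"
  unfolding smooth_on_open_def by (metis Ck_on.simps(1))

lemma smooth_map_onE:
  assumes "smooth_map_on S f" "x \<in> S"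
  obtains U F where "open U" "x \<in> U" "smooth_on_open F U" "\<And>y. y \<in> S \<Longrightarrow> y \<in> U \<Longrightarrow> F y = f y"
proof -
  have "\<exists>U F. x \<in> U \<and> smooth_on_open F U \<and> (\<forall>y\<in>S \<inter> U. F y = f y)"
    using assms(1)[unfolded smooth_map_on_def] assms(2) by (rule bspec)
  then obtain U F where "x \<in> U" "smooth_on_open F U" "\<forall>y\<in>S \<inter> U. F y = f y"
    by (elim exE conjE)
  then show thesis by (intro that[of U F]) (auto simp: smooth_on_open_def)
qed

lemma smooth_map_onI:
  assumes "\<And>x. x \<in> S \<Longrightarrow> \<exists>U F. x \<in> U \<and> smooth_on_open F U \<and> (\<forall>y\<in>S \<inter> U. F y = f y)"
  shows "smooth_map_on S f"
  using assms by (auto simp: smooth_map_on_def)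

lemma smooth_on_open_imp_smooth_map_on: "smooth_on_open f U \<Longrightarrow> S \<subseteq> U \<Longrightarrow> smooth_map_on S f"
  unfolding smooth_map_on_def by blast

lemma smooth_map_on_imp_smooth_on_open:
  assumes "smooth_map_on S f" "open S"
  shows "smooth_on_open f S"
  unfolding smooth_on_open_def
proof (intro conjI allI Ck_on_local)
  fix k x assume "x \<in> S"
  then obtain U F where F: "open U" "x \<in> U" "smooth_on_open F U" "\<And>y. y \<in> S \<Longrightarrow> y \<in> U \<Longrightarrow> F y = f y"
    using smooth_map_onE[OF assms(1) \<open>x \<in> S\<close>] by blast
  then have "Ck_on k F (S \<inter> U)" "open (S \<inter> U)"
    using assms(2) by (auto simp: smooth_on_open_def intro: Ck_on_subset)
  then show "\<exists>W. open W \<and> x \<in> W \<and> Ck_on k f W"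
    using Ck_on_cong[of "S \<inter> U" F f] F \<open>x \<in> S\<close> by blast
qed (rule assms)

lemma smooth_map_on_subset:
  assumes "smooth_map_on S f" "T \<subseteq> S"
  shows "smooth_map_on T f"
proof (rule smooth_map_onI)
  fix x assume "x \<in> T"
  then have x: "x \<in> S" using assms(2) by auto
  obtain U F where F: "open U" "x \<in> U" "smooth_on_open F U" "\<And>y. y \<in> S \<Longrightarrow> y \<in> U \<Longrightarrow> F y = f y"
    using smooth_map_onE[OF assms(1) x] by blast
  show "\<exists>U F. x \<in> U \<and> smooth_on_open F U \<and> (\<forall>y\<in>T \<inter> U. F y = f y)"
    by (rule exI[of _ U], rule exI[of _ F]) (use F assms(2) in auto)
qed

lemma smooth_map_on_cong:
  assumes "smooth_map_on S f" "\<And>x. x \<in> S \<Longrightarrow> f x = g x"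
  shows "smooth_map_on S g"
proof (rule smooth_map_onI)
  fix x assume x: "x \<in> S"
  obtain U F where F: "open U" "x \<in> U" "smooth_on_open F U" "\<And>y. y \<in> S \<Longrightarrow> y \<in> U \<Longrightarrow> F y = f y"
    using smooth_map_onE[OF assms(1) x] by blast
  show "\<exists>U F. x \<in> U \<and> smooth_on_open F U \<and> (\<forall>y\<in>S \<inter> U. F y = g y)"
    by (rule exI[of _ U], rule exI[of _ F]) (simp add: F assms(2))
qed

lemma smooth_map_on_compose:
  assumes "smooth_map_on S f" "smooth_map_on T g" "f ` S \<subseteq> T"
  shows "smooth_map_on S (\<lambda>x. g (f x))"
proof (rule smooth_map_onI)
  fix x assume x: "x \<in> S"
  obtain U F where F: "open U" "x \<in> U" "smooth_on_open F U" "\<And>y. y \<in> S \<Longrightarrow> y \<in> U \<Longrightarrow> F y = f y"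
    using smooth_map_onE[OF assms(1) x] by blast
  obtain V G where G: "open V" "f x \<in> V" "smooth_on_open G V" "\<And>y. y \<in> T \<Longrightarrow> y \<in> V \<Longrightarrow> G y = g y"
    using smooth_map_onE[OF assms(2), of "f x"] assms(3) x by blast
  have "open (U \<inter> F -` V)"
    using F G smooth_on_open_imp_continuous_on[of F U]
    by (auto simp: smooth_on_open_def continuous_on_open_vimage Int_commute)
  then have "smooth_on_open F (U \<inter> F -` V)"
    by (rule smooth_on_open_subset[OF F(3)]) auto
  then have "smooth_on_open (\<lambda>x. G (F x)) (U \<inter> F -` V)"
    by (rule smooth_on_open_compose[OF _ G(3)]) auto
  moreover have "x \<in> U \<inter> F -` V" using F G x by auto
  moreover have "\<forall>y\<in>S \<inter> (U \<inter> F -` V). G (F y) = g (f y)"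
    using F G assms(3) by auto
  ultimately show "\<exists>U F. x \<in> U \<and> smooth_on_open F U \<and> (\<forall>y\<in>S \<inter> U. F y = g (f y))"
    by (intro exI[of _ "U \<inter> F -` V"] exI[of _ "\<lambda>x. G (F x)"] conjI)
qed

text \<open>This is what allows the frame in the definition of the transport to be replaced by one that is
  smooth near the given point only.\<close>

lemma smooth_map_on_local:
  assumes "\<And>x. x \<in> S \<Longrightarrow> \<exists>W. open W \<and> x \<in> W \<and> smooth_map_on (S \<inter> W) f"
  shows "smooth_map_on S f"
proof (rule smooth_map_onI)
  fix x assume x: "x \<in> S"
  obtain W where W: "open W" "x \<in> W" "smooth_map_on (S \<inter> W) f" using assms[OF x] by blast
  then obtain U F where F: "open U" "x \<in> U" "smooth_on_open F U" "\<And>y. y \<in> S \<inter> W \<Longrightarrow> y \<in> U \<Longrightarrow> F y = f y"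
    using smooth_map_onE[OF W(3), of x] x by blast
  have "smooth_on_open F (W \<inter> U)"
    by (rule smooth_on_open_subset[OF F(3)]) (use F W in \<open>auto simp: smooth_on_open_def\<close>)
  then show "\<exists>U F. x \<in> U \<and> smooth_on_open F U \<and> (\<forall>y\<in>S \<inter> U. F y = f y)"
    using F W by (intro exI[of _ "W \<inter> U"] exI[of _ F]) auto
qed

named_theorems smooth_intros

lemma smooth_map_on_id [smooth_intros]: "smooth_map_on S (\<lambda>x. x)"
  by (rule smooth_on_open_imp_smooth_map_on[OF smooth_on_open_id[OF open_UNIV]]) auto

lemma smooth_map_on_const [smooth_intros]: "smooth_map_on S (\<lambda>x. c)"
  by (rule smooth_on_open_imp_smooth_map_on[of _ UNIV]) (auto simp: smooth_on_open_def Ck_on_const)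

lemma smooth_map_on_linear:
  assumes "bounded_linear L" "smooth_map_on S f"
  shows "smooth_map_on S (\<lambda>x. L (f x))"
  by (rule smooth_map_on_compose[OF assms(2) smooth_on_open_imp_smooth_map_on[OF
        smooth_on_open_linear[OF assms(1) smooth_on_open_id[OF open_UNIV]]]]) auto

lemma smooth_map_on_Pair [smooth_intros]:
  assumes "smooth_map_on S f" "smooth_map_on S g"
  shows "smooth_map_on S (\<lambda>x. (f x, g x))"
proof (rule smooth_map_onI)
  fix x assume x: "x \<in> S"
  obtain U F where F: "open U" "x \<in> U" "smooth_on_open F U" "\<And>y. y \<in> S \<Longrightarrow> y \<in> U \<Longrightarrow> F y = f y"
    using smooth_map_onE[OF assms(1) x] by blast
  obtain V G where G: "open V" "x \<in> V" "smooth_on_open G V" "\<And>y. y \<in> S \<Longrightarrow> y \<in> V \<Longrightarrow> G y = g y"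
    using smooth_map_onE[OF assms(2) x] by blast
  have "open (U \<inter> V)" using F G by (auto simp: smooth_on_open_def)
  then have "smooth_on_open (\<lambda>x. (F x, G x)) (U \<inter> V)"
    by (intro smooth_on_open_Pair smooth_on_open_subset[OF F(3)] smooth_on_open_subset[OF G(3)]) auto
  then show "\<exists>U F. x \<in> U \<and> smooth_on_open F U \<and> (\<forall>y\<in>S \<inter> U. F y = (f y, g y))"
    using F G by (intro exI[of _ "U \<inter> V"] exI[of _ "\<lambda>x. (F x, G x)"]) auto
qed

lemma smooth_map_on_bilinear:
  assumes "bounded_bilinear b" "smooth_map_on S f" "smooth_map_on S g"
  shows "smooth_map_on S (\<lambda>x. b (f x) (g x))"
proof -
  have "smooth_on_open (\<lambda>p. b (fst p) (snd p)) UNIV"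
    by (rule smooth_on_open_bilinear[OF assms(1)
          smooth_on_open_linear[OF bounded_linear_fst smooth_on_open_id[OF open_UNIV]]
          smooth_on_open_linear[OF bounded_linear_snd smooth_on_open_id[OF open_UNIV]]])
  then have "smooth_map_on S (\<lambda>x. b (fst (f x, g x)) (snd (f x, g x)))"
    by (intro smooth_map_on_compose[OF smooth_map_on_Pair[OF assms(2,3)]
          smooth_on_open_imp_smooth_map_on]) auto
  then show ?thesis by simp
qed

lemmas smooth_map_on_fst [smooth_intros] = smooth_map_on_linear[OF bounded_linear_fst]
lemmas smooth_map_on_snd [smooth_intros] = smooth_map_on_linear[OF bounded_linear_snd]
lemmas smooth_map_on_scaleR [smooth_intros] = smooth_map_on_bilinear[OF bounded_bilinear_scaleR]
lemmas smooth_map_on_minus [smooth_intros] =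
  smooth_map_on_linear[OF bounded_linear_minus[OF bounded_linear_ident]]

lemma smooth_map_on_add [smooth_intros]:
  assumes "smooth_map_on S f" "smooth_map_on S g"
  shows "smooth_map_on S (\<lambda>x. f x + g x)"
  using smooth_map_on_linear[OF bounded_linear_add[OF bounded_linear_fst bounded_linear_snd]
    smooth_map_on_Pair[OF assms]] by simp

lemma smooth_map_on_diff [smooth_intros]:
  assumes "smooth_map_on S f" "smooth_map_on S g"
  shows "smooth_map_on S (\<lambda>x. f x - g x)"
  using smooth_map_on_linear[OF bounded_linear_sub[OF bounded_linear_fst bounded_linear_snd]
    smooth_map_on_Pair[OF assms]] by simp

lemma smooth_map_on_imp_continuous_on:
  assumes "smooth_map_on S f" shows "continuous_on S f"
  unfolding continuous_on_eq_continuous_within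
proof
  fix x assume x: "x \<in> S"
  obtain U F where F: "open U" "x \<in> U" "smooth_on_open F U" "\<And>y. y \<in> S \<Longrightarrow> y \<in> U \<Longrightarrow> F y = f y"
    using smooth_map_onE[OF assms x] by blast
  then have "open U" "continuous_on U F"
    using smooth_on_open_imp_continuous_on by (auto simp: smooth_on_open_def)
  then have "isCont F x" using F continuous_on_eq_continuous_at by blast
  then have "continuous (at x within S) F"
    using continuous_at_imp_continuous_at_within by blast
  then have *: "(F \<longlongrightarrow> f x) (at x within S)" using F x by (auto simp: continuous_within)
  have "eventually (\<lambda>y. F y = f y) (at x within S)"
    using F \<open>open U\<close> unfolding eventually_at_topological by auto
  then show "continuous (at x within S) f"
    using * by (simp add: continuous_within tendsto_cong)
qed


section \<open>Smooth dependence of solutions of linear equations\<close>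

text \<open>The first factor vanishes at \<open>a\<close>, so continuity of \<open>g\<close> is enough for the product rule. In this
  form it differentiates a solution of a linear equation that is only known to be continuous.\<close>

lemma has_derivative_bilinear_vanishing:
  assumes b: "bounded_bilinear b" and g: "isCont g a"
  shows "((\<lambda>x. b (x - a) (g x)) has_derivative (\<lambda>v. b v (g a))) (at a)"
proof -
  interpret bounded_bilinear b by (rule b)
  obtain K where K: "\<And>x y. norm (b x y) \<le> norm x * norm y * K"
    using bounded by blast
  have lim: "((\<lambda>x. norm (g x - g a) * K) \<longlongrightarrow> 0) (at a)"
    using g by (intro tendsto_mult_left_zero tendsto_norm_zero) (simp add: isCont_def LIM_zero)
  have "norm (norm (b (x - a) (g x) - b (a - a) (g a) - b (x - a) (g a)) / norm (x - a))
      \<le> norm (g x - g a) * K" if "x \<noteq> a" for x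
  proof -
    have "b (x - a) (g x) - b (a - a) (g a) - b (x - a) (g a) = b (x - a) (g x - g a)"
      by (simp add: diff_right zero_left)
    then show ?thesis using K[of "x - a" "g x - g a"] that
      by (simp add: divide_simps mult_ac)
  qed
  then have "((\<lambda>x. norm (b (x - a) (g x) - b (a - a) (g a) - b (x - a) (g a)) / norm (x - a))
      \<longlongrightarrow> 0) (at a)"
    by (intro Lim_null_comparison[OF _ lim]) (auto simp: eventually_at_filter)
  then show ?thesis
    by (simp add: has_derivative_iff_norm bounded_linear_left)
qed

lemma has_derivative_zero_quadratic:
  assumes "open U" "a \<in> U" "\<And>x. x \<in> U \<Longrightarrow> norm (f x) \<le> K * (norm (x - a))\<^sup>2"
  shows "(f has_derivative (\<lambda>v. 0)) (at a)"
proof -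
  have fa: "f a = 0" using assms(3)[OF assms(2)] by simp
  have lim: "((\<lambda>x. K * norm (x - a)) \<longlongrightarrow> 0) (at a)"
    by (rule tendsto_eq_intros | simp)+
  have "norm (norm (f x - f a - 0) / norm (x - a)) \<le> K * norm (x - a)"
    if "x \<in> U" "x \<noteq> a" for x
    using assms(3)[OF that(1)] that(2) fa by (simp add: divide_simps power2_eq_square mult_ac)
  then have "((\<lambda>x. norm (f x - f a - 0) / norm (x - a)) \<longlongrightarrow> 0) (at a)"
    using assms(1,2) by (intro Lim_null_comparison[OF _ lim]) (auto simp: eventually_at_topological)
  then show ?thesis by (simp add: has_derivative_iff_norm)
qed

text \<open>Differentiating \<open>L S (z S) = w S\<close> shows that the derivative of \<open>z\<close> in a direction \<open>v\<close>
  solves the same equation with right-hand side \<open>w' v - L v (z S)\<close>; hence the order of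
  differentiability can be raised by induction.\<close>

lemma Ck_on_linear_solution:
  fixes L :: "'a::real_normed_vector \<Rightarrow> 'b::euclidean_space \<Rightarrow> 'b"
  assumes L: "bounded_bilinear L" and U: "open U"
    and inj: "\<And>S x. S \<in> U \<Longrightarrow> L S x = 0 \<Longrightarrow> x = 0"
    and "Ck_on k w U" and "\<And>S. S \<in> U \<Longrightarrow> L S (z S) = w S"
  shows "Ck_on k z U"
proof -
  interpret bounded_bilinear L by (rule L)
  have lin: "linear (L S)" for S
    using bounded_linear_right bounded_linear.linear by blast
  have injL: "inj (L S)" if "S \<in> U" for S
    using inj[OF that] linear_injective_0[OF lin] by blast
  have cont: "continuous_on U z"
    if w: "continuous_on U w" and z: "\<And>S. S \<in> U \<Longrightarrow> L S (z S) = w S" for w z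
    unfolding continuous_on_eq_continuous_at[OF U]
  proof
    fix S assume S: "S \<in> U"
    obtain B where B: "B > 0" "\<And>x. B * norm x \<le> norm (L S x)"
      using linear_inj_bounded_below_pos[OF lin injL[OF S]] by blast
    obtain K where K: "K > 0" "\<And>x y. norm (L x y) \<le> norm x * norm y * K"
      using pos_bounded by blast
    \<comment> \<open>Near \<open>S\<close> the operators \<open>L T\<close> are bounded below by \<open>B / 2\<close>, and \<open>L T\<close> maps \<open>z T - z S\<close> to the
      small quantity \<open>?r T\<close>.\<close>
    let ?r = "\<lambda>T. w T - w S - L (T - S) (z S)"
    have wS: "isCont w S" using w S U continuous_on_eq_continuous_at by blast
    have "isCont ?r S"
      by (intro continuous_intros wS bounded_linear.isCont[OF bounded_linear_left])
    then have "((\<lambda>T. ?r T) \<longlongrightarrow> 0) (at S)"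
      by (simp add: isCont_def zero_left)
    then have "((\<lambda>T. 2 / B * norm (?r T)) \<longlongrightarrow> 0) (at S)"
      by (intro tendsto_mult_right_zero tendsto_norm_zero)
    moreover have "\<forall>\<^sub>F T in at S. norm (z T - z S) \<le> 2 / B * norm (?r T)"
    proof -
      have "\<forall>\<^sub>F T in at S. dist T S < B / (2 * K)"
        using B K by (auto simp: eventually_at intro!: exI[of _ "B / (2 * K)"])
      moreover have "\<forall>\<^sub>F T in at S. T \<in> U"
        using U S by (rule eventually_at_in_open')
      ultimately show ?thesis
      proof eventually_elim
        case (elim T)
        define d where "d = z T - z S"
        have *: "?r T = L S d + L (T - S) d"
          using z[OF S] z[OF elim(2)] by (simp add: d_def diff_left diff_right)
        have "norm (L (T - S) d) \<le> norm (T - S) * norm d * K" by (rule K)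
        also have "\<dots> \<le> B / (2 * K) * norm d * K"
          using elim(1) K(1) by (intro mult_right_mono) (auto simp: dist_norm)
        also have "\<dots> = B / 2 * norm d" using K(1) by simp
        finally have "B / 2 * norm d \<le> norm (?r T)"
          using B(2)[of d] norm_diff_ineq[of "L S d" "L (T - S) d"] unfolding * by simp
        then show ?case using B(1) by (simp add: d_def field_simps)
      qed
    qed
    ultimately have "((\<lambda>T. z T - z S) \<longlongrightarrow> 0) (at S)"
      by (rule Lim_null_comparison[rotated])
    then show "isCont z S"
      by (simp add: isCont_def LIM_zero_iff)
  qed
  show ?thesis using assms(4,5)
  proof (induction k arbitrary: w z)
    case 0
    then show ?case using cont by simp
  next
    case (Suc k)
    have wk: "Ck_on k w U" using Ck_on_SucD Suc.prems(1) by blast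
    then have zk: "Ck_on k z U" using Suc.IH Suc.prems(2) by blast
    define w' where "w' = (\<lambda>S. frechet_derivative w (at S))"
    have w': "(w has_derivative w' S) (at S)" if "S \<in> U" for S
      unfolding w'_def using Ck_on_has_derivative[OF Suc.prems(1) that] .
    have "\<exists>g. linear g \<and> g \<circ> L S = id" if "S \<in> U" for S
      using linear_injective_left_inverse[OF lin injL[OF that]] by blast
    then obtain g where g: "\<And>S. S \<in> U \<Longrightarrow> linear (g S)" "\<And>S x. S \<in> U \<Longrightarrow> g S (L S x) = x"
      unfolding o_def fun_eq_iff id_def by metis
    have surjL: "surj (L S)" if "S \<in> U" for S
      using linear_injective_imp_surjective[OF lin injL[OF that]] by blast
    have Lg: "L S (g S y) = y" if S: "S \<in> U" for S y
    proof -
      obtain x where "y = L S x" using surjD[OF surjL[OF S], of y] by blast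
      then show ?thesis using g(2)[OF S] by simp
    qed
    have z': "(z has_derivative (\<lambda>v. g S (w' S v - L v (z S)))) (at S)" if S: "S \<in> U" for S
    proof -
      have "isCont z S"
        using Ck_on_imp_continuous_on[OF zk] S U continuous_on_eq_continuous_at by blast
      then have "((\<lambda>T. L (T - S) (z T)) has_derivative (\<lambda>v. L v (z S))) (at S)"
        by (rule has_derivative_bilinear_vanishing[OF L])
      then have "((\<lambda>T. g S (w T - L (T - S) (z T))) has_derivative (\<lambda>v. g S (w' S v - L v (z S)))) (at S)"
        by (intro bounded_linear.has_derivative[OF linear_conv_bounded_linear[THEN iffD1, OF g(1)[OF S]]]
            has_derivative_diff w' S)
      moreover have "g S (w T - L (T - S) (z T)) = z T" if "T \<in> U" for T
        using Suc.prems(2)[OF that] g(2)[OF S, of "z T"] by (simp add: diff_left)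
      ultimately show ?thesis
        using has_derivative_transform_within_open[OF _ U S] by blast
    qed
    show ?case
    proof (rule Ck_on_SucI[OF U z'])
      fix v
      have "Ck_on k (\<lambda>S. w' S v + - L v (z S)) U"
        by (intro Ck_on_add U Ck_on_linear[OF bounded_linear_minus[OF bounded_linear_right]] zk)
          (use Suc.prems(1) in \<open>simp add: w'_def\<close>)
      then show "Ck_on k (\<lambda>S. g S (w' S v - L v (z S))) U"
        by (rule Suc.IH) (simp add: Lg)
    qed
  qed
qed

section \<open>Smooth matrix operations\<close>

lemma matrix_minus_left: "(- A) ** B = - (A ** (B :: real^'k^'n))"
  and matrix_minus_right: "A ** (- B) = - (A ** (B :: real^'k^'n))"
  and matrix_diff_left: "(A - C) ** B = A ** B - C ** (B :: real^'k^'n)"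
  and matrix_diff_right: "D ** (B - E) = D ** B - D ** (E :: real^'k^'n)"
  and matrix_add_left: "(A + C) ** B = A ** B + C ** (B :: real^'k^'n)"
  and matrix_scaleR_left: "(c *\<^sub>R A) ** B = c *\<^sub>R (A ** (B :: real^'k^'n))"
  and matrix_scaleR_right: "A ** (c *\<^sub>R B) = c *\<^sub>R (A ** (B :: real^'k^'n))"
  by (simp_all add: vec_eq_iff matrix_matrix_mult_def sum_negf sum_subtractf sum.distrib
      algebra_simps sum_distrib_left)

lemmas matrix_distribs = matrix_minus_left matrix_minus_right matrix_diff_left matrix_diff_right
  matrix_add_left matrix_add_ldistrib matrix_scaleR_left matrix_scaleR_right

lemma transpose_add: "transpose (A + B) = transpose A + transpose (B :: real^'n^'m)"
  and transpose_diff: "transpose (A - B) = transpose A - transpose (B :: real^'n^'m)"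
  and transpose_minus: "transpose (- A) = - transpose (A :: real^'n^'m)"
  and transpose_0: "transpose 0 = (0 :: real^'n^'m)"
  by (simp_all add: transpose_def vec_eq_iff)

lemmas transpose_simps = matrix_transpose_mul transpose_add transpose_diff transpose_minus
  transpose_0 transpose_scalar

lemma bounded_bilinear_matrix_mult:
  "bounded_bilinear ((**) :: real^'n^'m \<Rightarrow> real^'k^'n \<Rightarrow> real^'k^'m)"
  by (simp add: bilinear_conv_bounded_bilinear[symmetric] bilinear_def linear_iff matrix_distribs)

lemma bounded_linear_transpose: "bounded_linear (transpose :: real^'n^'m \<Rightarrow> real^'m^'n)"
  by (simp add: linear_conv_bounded_linear[symmetric] linear_iff transpose_simps)

lemmas smooth_map_on_mult [smooth_intros] = smooth_map_on_bilinear[OF bounded_bilinear_matrix_mult]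
lemmas smooth_map_on_transpose [smooth_intros] = smooth_map_on_linear[OF bounded_linear_transpose]

lemma matrix_inv_mult:
  fixes A :: "real^'n^'n"
  assumes "invertible A"
  shows "A ** matrix_inv A = mat 1" "matrix_inv A ** A = mat 1"
  using someI_ex[of "\<lambda>A'. A ** A' = mat 1 \<and> A' ** A = mat 1"] assms
  unfolding invertible_def matrix_inv_def by auto

lemma matrix_inv_unique:
  fixes A :: "real^'n^'n"
  assumes "A ** B = mat 1"
  shows "matrix_inv A = B"
proof -
  have "invertible A" using assms invertible_right_inverse by blast
  then have "B = matrix_inv A ** (A ** B)"
    by (simp add: matrix_mul_assoc matrix_inv_mult)
  then show ?thesis using assms by simp
qed

lemma open_invertible: "open {A :: real^'n^'n. invertible A}"
proof -
  have "continuous_on UNIV (det :: real^'n^'n \<Rightarrow> real)"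
    unfolding det_def by (intro continuous_intros)
  then have "open (det -` (- {0::real}) :: (real^'n^'n) set)"
    by (rule open_vimage[rotated]) auto
  then show ?thesis by (simp add: invertible_det_nz vimage_def)
qed

lemma smooth_on_open_matrix_inv: "smooth_on_open matrix_inv {A :: real^'n^'n. invertible A}"
proof -
  have "A ** X = 0 \<Longrightarrow> X = 0" if "invertible A" for A X :: "real^'n^'n"
    using matrix_inv_mult[OF that] by (metis matrix_mul_assoc matrix_mul_lid times0_right)
  then have "Ck_on k matrix_inv {A :: real^'n^'n. invertible A}" for k
    by (intro Ck_on_linear_solution[OF bounded_bilinear_matrix_mult open_invertible _ Ck_on_const[of k "mat 1"]])
      (auto simp: matrix_inv_mult)
  then show ?thesis
    by (simp add: smooth_on_open_def open_invertible)
qed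

lemma smooth_map_on_matrix_inv [smooth_intros]:
  fixes f :: "'a::euclidean_space \<Rightarrow> real^'n^'n"
  assumes "smooth_map_on S f" "\<And>x. x \<in> S \<Longrightarrow> invertible (f x)"
  shows "smooth_map_on S (\<lambda>x. matrix_inv (f x))"
  by (rule smooth_map_on_compose[OF assms(1)
        smooth_on_open_imp_smooth_map_on[OF smooth_on_open_matrix_inv subset_refl]])
    (use assms(2) in auto)


section \<open>Square roots of positive definite matrices\<close>

lemma linear_le_quadratic_imp_zero:
  fixes a c :: real
  assumes "\<And>t. 2 * t * a \<le> t\<^sup>2 * c" "0 \<le> c"
  shows "a = 0"
proof -
  define s where "s = a / (c + 1)"
  have a: "a = s * (c + 1)" using assms(2) by (simp add: s_def)
  have "s\<^sup>2 * (c + 2) \<le> 0"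
    using assms(1)[of s] by (simp add: a algebra_simps power2_eq_square)
  then show ?thesis
    using assms(2) by (simp add: a mult_le_0_iff)
qed

text \<open>A maximizer of the quadratic form on the unit sphere of \<open>S\<close> is an eigenvector, and its
  orthogonal complement in \<open>S\<close> is again invariant; induction on the dimension does the rest.\<close>

lemma selfadjoint_eigenbasis:
  fixes f :: "'a::euclidean_space \<Rightarrow> 'a"
  assumes f: "linear f" and sa: "\<And>x y. f x \<bullet> y = x \<bullet> f y"
    and "subspace S" "f ` S \<subseteq> S"
  shows "\<exists>B. pairwise orthogonal B \<and> (\<forall>b\<in>B. norm b = 1 \<and> f b = (b \<bullet> f b) *\<^sub>R b) \<and> span B = S"
  using assms(3,4)
proof (induction "dim S" arbitrary: S rule: less_induct)
  case less
  interpret f: linear f by (rule f)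
  show ?case
  proof (cases "S = {0}")
    case True
    then show ?thesis by (intro exI[of _ "{}"]) auto
  next
    case False
    let ?K = "sphere 0 1 \<inter> S"
    have "compact ?K"
      using closed_subspace[OF less.prems(1)] by (intro compact_Int_closed) auto
    moreover have "?K \<noteq> {}"
    proof -
      obtain x where "x \<in> S" "x \<noteq> 0" using False subspace_0[OF less.prems(1)] by auto
      then have "x /\<^sub>R norm x \<in> ?K" using less.prems(1) by (auto simp: subspace_scale)
      then show ?thesis by blast
    qed
    moreover have "continuous_on ?K (\<lambda>x. x \<bullet> f x)"
      by (intro continuous_intros linear_continuous_on linear_conv_bounded_linear[THEN iffD1] f)
    ultimately obtain u where u: "u \<in> ?K" and max: "\<And>x. x \<in> ?K \<Longrightarrow> x \<bullet> f x \<le> u \<bullet> f u"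
      using continuous_attains_sup[of ?K "\<lambda>x. x \<bullet> f x"] by blast
    have uu: "u \<bullet> u = 1" "norm u = 1" "u \<in> S" using u by (auto simp: norm_eq_1)
    define l where "l = u \<bullet> f u"
    have quad: "x \<bullet> f x \<le> l * (x \<bullet> x)" if "x \<in> S" for x
    proof (cases "x = 0")
      case False
      have "x /\<^sub>R norm x \<in> ?K" using False that less.prems(1) by (auto simp: subspace_scale)
      from max[OF this] show ?thesis
        using False unfolding l_def
        by (simp add: f.scale divide_simps power2_norm_eq_inner[symmetric] power2_eq_square mult_ac)
    qed (simp add: f.zero)
    \<comment> \<open>A linear term at the maximum would make the quadratic form exceed its bound.\<close>
    have orth: "v \<bullet> f u = 0" if v: "v \<in> S" "v \<bullet> u = 0" for v
    proof -
      let ?a = "v \<bullet> f u" and ?c = "l * (v \<bullet> v) - v \<bullet> f v"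
      have *: "2 * t * ?a \<le> t\<^sup>2 * ?c" for t
      proof -
        have "u + t *\<^sub>R v \<in> S" using v uu less.prems(1) by (simp add: subspace_add subspace_scale)
        from quad[OF this] show ?thesis
          using v(2) uu sa[of u v] unfolding l_def
          by (simp add: f.add f.scale inner_add_left inner_add_right algebra_simps
              inner_commute power2_eq_square)
      qed
      have c: "0 \<le> ?c" using quad[OF v(1)] by simp
      show ?thesis using linear_le_quadratic_imp_zero[OF * c] .
    qed
    have eig: "f u = l *\<^sub>R u"
    proof -
      let ?w = "f u - l *\<^sub>R u"
      have wS: "?w \<in> S" using uu less.prems by (auto intro!: subspace_diff subspace_scale)
      have wu: "?w \<bullet> u = 0" using uu by (simp add: inner_diff_left l_def) (simp add: inner_commute)
      have "?w \<bullet> ?w = ?w \<bullet> f u - l * (?w \<bullet> u)"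
        by (subst inner_diff_right) simp
      then have "?w \<bullet> ?w = 0" using orth[OF wS wu] wu by simp
      then show ?thesis by simp
    qed
    let ?T = "{v \<in> S. v \<bullet> u = 0}"
    have T: "subspace ?T"
      using less.prems(1) by (auto simp: subspace_def inner_add_left)
    have fT: "f ` ?T \<subseteq> ?T"
      using less.prems(2) sa eig by auto
    have "span ?T \<subset> span S"
    proof -
      have "u \<notin> ?T" using uu by simp
      then have "?T \<subset> S" using uu by blast
      moreover have "span ?T = ?T" "span S = S" using T less.prems(1) by (simp_all add: span_eq_iff)
      ultimately show ?thesis by (simp only:)
    qed
    then have "dim ?T < dim S" by (rule dim_psubset)
    from less.hyps[OF this T fT] obtain B where B: "pairwise orthogonal B"
      "\<forall>b\<in>B. norm b = 1 \<and> f b = (b \<bullet> f b) *\<^sub>R b" "span B = ?T" by blast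
    have BT: "B \<subseteq> ?T" using B(3) span_superset by blast
    have "pairwise orthogonal (insert u B)"
      using B(1) BT by (auto simp: pairwise_insert orthogonal_def inner_commute)
    moreover have "\<forall>b\<in>insert u B. norm b = 1 \<and> f b = (b \<bullet> f b) *\<^sub>R b"
      using B(2) uu eig by (simp add: l_def)
    moreover have "span (insert u B) = S"
    proof
      show "span (insert u B) \<subseteq> S"
        using BT uu less.prems(1) by (intro span_minimal) auto
      show "S \<subseteq> span (insert u B)"
      proof
        fix x assume "x \<in> S"
        then have "x - (x \<bullet> u) *\<^sub>R u \<in> ?T"
          using uu less.prems(1) by (auto intro!: subspace_diff subspace_scale simp: inner_diff_left)
        then have "x - (x \<bullet> u) *\<^sub>R u \<in> span B" using B(3) by simp
        then show "x \<in> span (insert u B)" unfolding span_insert by blast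
      qed
    qed
    ultimately show ?thesis by blast
  qed
qed

lemma inner_self_le_0_iff: "x \<bullet> x \<le> 0 \<longleftrightarrow> x = (0 :: 'a::real_inner)"
  by (metis inner_eq_zero_iff inner_ge_zero order.refl order_antisym)

text \<open>Symmetry is left out of the definition so that these matrices form an open set. The uniform bound
  \<open>c\<close>, which by compactness of the sphere amounts to strict positivity, is the constant in the
  estimates below.\<close>

definition posdef :: "real^'r^'r \<Rightarrow> bool" where
  "posdef A \<longleftrightarrow> (\<exists>c>0. \<forall>x. c * (x \<bullet> x) \<le> x \<bullet> (A *v x))"

lemma transpose_quadratic_form: "x \<bullet> (transpose A *v x) = x \<bullet> (A *v (x :: real^'r))"
  using dot_lmul_matrix[of x A x] by (simp add: inner_commute)

lemma inner_transpose_transpose: "transpose A \<bullet> transpose B = A \<bullet> (B :: real^'n^'m)"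
  unfolding inner_vec_def transpose_def by simp (rule sum.swap)

text \<open>The quadratic form estimate applied to every row of \<open>D\<close>.\<close>

lemma inner_mult_right_ge:
  fixes D :: "real^'r^'k"
  assumes "\<And>x. c * (x \<bullet> x) \<le> x \<bullet> (S *v x)"
  shows "c * (D \<bullet> D) \<le> D \<bullet> (D ** S)"
proof -
  have row: "(D ** S) $ i = transpose S *v (D $ i)" for i
    by (simp add: vec_eq_iff matrix_matrix_mult_def matrix_vector_mult_def transpose_def mult.commute)
  have "c * (D \<bullet> D) = (\<Sum>i\<in>UNIV. c * (D $ i \<bullet> D $ i))"
    by (simp add: inner_vec_def[of D] sum_distrib_left)
  also have "\<dots> \<le> (\<Sum>i\<in>UNIV. D $ i \<bullet> (D ** S) $ i)"
    unfolding row transpose_quadratic_form by (intro sum_mono assms)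
  also have "\<dots> = D \<bullet> (D ** S)" by (simp add: inner_vec_def[of D])
  finally show ?thesis .
qed

lemma inner_mult_left_ge:
  fixes D :: "real^'k^'r"
  assumes "\<And>x. c * (x \<bullet> x) \<le> x \<bullet> (S *v x)"
  shows "c * (D \<bullet> D) \<le> D \<bullet> (S ** D)"
proof -
  have "c * (transpose D \<bullet> transpose D) \<le> transpose D \<bullet> (transpose D ** transpose S)"
    by (intro inner_mult_right_ge) (simp add: transpose_quadratic_form assms del: transpose_matrix_vector)
  then show ?thesis
    by (simp add: inner_transpose_transpose matrix_transpose_mul[symmetric])
qed

lemma posdef_imp_invertible:
  fixes A :: "real^'r^'r"
  assumes "posdef A" shows "invertible A"
proof -
  obtain c where c: "c > 0" "\<And>x. c * (x \<bullet> x) \<le> x \<bullet> (A *v x)"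
    using assms by (auto simp: posdef_def)
  have "x = 0" if "A *v x = 0" for x
    using c(2)[of x] c(1) that by (simp add: mult_le_0_iff inner_self_le_0_iff)
  then show ?thesis
    using matrix_left_invertible_ker[of A] invertible_left_inverse by blast
qed

lemma open_posdef: "open {A :: real^'r^'r. posdef A}"
  unfolding open_dist
proof
  fix A :: "real^'r^'r" assume "A \<in> {A. posdef A}"
  then obtain c where c: "c > 0" "\<And>x. c * (x \<bullet> x) \<le> x \<bullet> (A *v x)"
    by (auto simp: posdef_def)
  have "bounded_bilinear ((*v) :: real^'r^'r \<Rightarrow> real^'r \<Rightarrow> real^'r)"
    by (simp add: bilinear_conv_bounded_bilinear[symmetric] bilinear_def linear_iff
        matrix_vector_mult_add_rdistrib matrix_vector_right_distrib scaleR_matrix_vector_assoc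
        matrix_vector_mult_scaleR)
  then obtain K where K: "K > 0" "\<And>(M :: real^'r^'r) x. norm (M *v x) \<le> norm M * norm x * K"
    using bounded_bilinear.pos_bounded by blast
  have "posdef B" if B: "dist B A < c / (2 * K)" for B
    unfolding posdef_def
  proof (intro exI[of _ "c / 2"] conjI allI)
    fix x
    have "\<bar>x \<bullet> ((A - B) *v x)\<bar> \<le> norm x * norm ((A - B) *v x)"
      by (rule Cauchy_Schwarz_ineq2)
    also have "\<dots> \<le> norm x * (norm (A - B) * norm x * K)"
      by (intro mult_left_mono K) auto
    also have "\<dots> = norm (A - B) * K * (x \<bullet> x)"
      by (simp add: power2_norm_eq_inner[symmetric] power2_eq_square)
    also have "\<dots> \<le> c / (2 * K) * K * (x \<bullet> x)"
      using B K(1) by (intro mult_right_mono) (auto simp: dist_norm norm_minus_commute)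
    finally have "x \<bullet> ((A - B) *v x) \<le> c / 2 * (x \<bullet> x)"
      using K(1) by simp
    then have "x \<bullet> (A *v x) - x \<bullet> (B *v x) \<le> c / 2 * (x \<bullet> x)"
      by (simp add: matrix_vector_mult_diff_rdistrib inner_diff_right)
    then show "c / 2 * (x \<bullet> x) \<le> x \<bullet> (B *v x)" using c(2)[of x] by simp
  qed (use c in simp)
  then show "\<exists>e>0. \<forall>B. dist B A < e \<longrightarrow> B \<in> {A. posdef A}"
    using c K by (intro exI[of _ "c / (2 * K)"]) auto
qed

text \<open>In an orthonormal eigenbasis the root is diagonal, with the roots of the eigenvalues; these are
  bounded below by the root of the bound for \<open>A\<close>.\<close>

lemma posdef_sqrt_exists:
  fixes A :: "real^'r^'r"
  assumes "transpose A = A" "posdef A"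
  shows "\<exists>S. transpose S = S \<and> posdef S \<and> S ** S = A"
proof -
  obtain c where c: "c > 0" "\<And>x. c * (x \<bullet> x) \<le> x \<bullet> (A *v x)"
    using assms(2) by (auto simp: posdef_def)
  have sa: "(A *v x) \<bullet> y = x \<bullet> (A *v y)" for x y
    using dot_lmul_matrix[of x A y] assms(1) by (metis transpose_matrix_vector)
  obtain B where B: "pairwise orthogonal B" "span B = UNIV"
    and B1: "\<And>b. b \<in> B \<Longrightarrow> norm b = 1" and eig: "\<And>b. b \<in> B \<Longrightarrow> A *v b = (b \<bullet> (A *v b)) *\<^sub>R b"
    using selfadjoint_eigenbasis[of "(*v) A" UNIV] sa by auto
  have finB: "finite B"
    using B(1) B1 by (intro pairwise_orthogonal_imp_finite)
  have bb: "b \<bullet> b' = (if b = b' then 1 else 0)" if "b \<in> B" "b' \<in> B" for b b'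
    using B(1) B1 that by (auto simp: pairwise_def orthogonal_def norm_eq_1)
  have expand: "(\<Sum>b\<in>B. (x \<bullet> b) *\<^sub>R b) = x" for x
    using orthonormal_basis_expand[OF B(1) B1 _ finB, of x] B(2) by simp
  define l where "l = (\<lambda>b. sqrt (b \<bullet> (A *v b)))"
  have lc: "c \<le> b \<bullet> (A *v b)" if "b \<in> B" for b
    using c(2)[of b] B1[OF that] by (simp add: norm_eq_1)
  have l: "l b * l b = b \<bullet> (A *v b)" "sqrt c \<le> l b" if "b \<in> B" for b
    using lc[OF that] c(1) by (auto simp: l_def)
  define g where "g x = (\<Sum>b\<in>B. (l b * (x \<bullet> b)) *\<^sub>R b)" for x
  have lin: "linear g"
    by (rule linearI) (simp_all add: g_def inner_add_left algebra_simps sum.distrib scaleR_sum_right)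
  have gb: "g x \<bullet> b = l b * (x \<bullet> b)" if "b \<in> B" for x b
  proof -
    have "g x \<bullet> b = (\<Sum>b'\<in>B. if b' = b then l b * (x \<bullet> b) else 0)"
      unfolding g_def inner_sum_left by (rule sum.cong) (auto simp: bb that)
    then show ?thesis using finB that by simp
  qed
  have gg: "g (g x) = A *v x" for x
  proof -
    have "g (g x) = (\<Sum>b\<in>B. (x \<bullet> b) *\<^sub>R (A *v b))"
      unfolding g_def[of "g x"]
    proof (rule sum.cong[OF refl])
      fix b assume b: "b \<in> B"
      have "(l b * (g x \<bullet> b)) *\<^sub>R b = (x \<bullet> b) *\<^sub>R ((b \<bullet> (A *v b)) *\<^sub>R b)"
        unfolding gb[OF b] l(1)[OF b, symmetric] by (simp add: mult_ac)
      then show "(l b * (g x \<bullet> b)) *\<^sub>R b = (x \<bullet> b) *\<^sub>R (A *v b)"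
        using eig[OF b] by simp
    qed
    also have "\<dots> = A *v (\<Sum>b\<in>B. (x \<bullet> b) *\<^sub>R b)"
      by (simp add: linear_sum[OF matrix_vector_mul_linear] linear_scale[OF matrix_vector_mul_linear])
    finally show ?thesis by (simp add: expand)
  qed
  have gx: "g x \<bullet> y = (\<Sum>b\<in>B. l b * (x \<bullet> b) * (y \<bullet> b))" for x y
    unfolding g_def inner_sum_left by (simp add: inner_commute)
  have gsa: "g x \<bullet> y = x \<bullet> g y" for x y
    by (subst inner_commute[of x]) (simp add: gx mult_ac)
  have gc: "sqrt c * (x \<bullet> x) \<le> x \<bullet> g x" for x
  proof -
    have "sqrt c * (x \<bullet> x) = sqrt c * ((\<Sum>b\<in>B. (x \<bullet> b) *\<^sub>R b) \<bullet> x)" by (simp add: expand)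
    also have "\<dots> = (\<Sum>b\<in>B. sqrt c * (x \<bullet> b)\<^sup>2)"
      by (simp add: inner_sum_left sum_distrib_left power2_eq_square) (simp add: inner_commute)
    also have "\<dots> \<le> (\<Sum>b\<in>B. l b * (x \<bullet> b)\<^sup>2)"
      by (intro sum_mono mult_right_mono l) auto
    also have "\<dots> = g x \<bullet> x" by (simp add: gx power2_eq_square mult_ac)
    finally show ?thesis by (simp add: inner_commute)
  qed
  define S where "S = matrix g"
  have S: "S *v x = g x" for x
    unfolding S_def by (simp add: lin matrix_works)
  have "adjoint g = g" using gsa by (intro adjoint_unique) simp
  then have "transpose S = S" unfolding S_def using matrix_adjoint[OF lin] by simp
  moreover have "posdef S" unfolding posdef_def S using gc c(1) by (intro exI[of _ "sqrt c"]) auto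
  moreover have "S ** S = A"
    by (simp add: matrix_eq matrix_vector_mul_assoc[symmetric] S gg)
  ultimately show ?thesis by blast
qed

text \<open>Two roots \<open>S\<close> and \<open>T\<close> satisfy \<open>T ** T - S ** S = T ** (T - S) + (T - S) ** S\<close>. Pairing
  this identity with \<open>T - S\<close> bounds the difference of the roots by the difference of the squares,
  which gives both uniqueness and continuity.\<close>

lemma sqrt_lipschitz:
  fixes S T :: "real^'r^'r"
  assumes "\<And>x. c * (x \<bullet> x) \<le> x \<bullet> (S *v x)" "\<And>x. 0 \<le> x \<bullet> (T *v x)"
  shows "c * norm (T - S) \<le> norm (T ** T - S ** S)"
proof (cases "T = S")
  case False
  let ?D = "T - S"
  have "c * (?D \<bullet> ?D) \<le> ?D \<bullet> (?D ** S)" using assms(1) by (rule inner_mult_right_ge)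
  moreover have "0 * (?D \<bullet> ?D) \<le> ?D \<bullet> (T ** ?D)" using assms(2) by (intro inner_mult_left_ge) simp
  ultimately have "c * (?D \<bullet> ?D) \<le> ?D \<bullet> (T ** ?D + ?D ** S)" by (simp add: inner_add_right)
  also have "T ** ?D + ?D ** S = T ** T - S ** S" by (simp add: matrix_distribs)
  also have "?D \<bullet> \<dots> \<le> norm ?D * norm (T ** T - S ** S)" by (rule norm_cauchy_schwarz)
  finally have "norm ?D * (c * norm ?D) \<le> norm ?D * norm (T ** T - S ** S)"
    by (simp add: power2_norm_eq_inner[symmetric] power2_eq_square mult_ac)
  then show ?thesis using False by simp
qed simp

lemma matrix_sqrt_eqI:
  assumes "transpose S = S" "posdef S" "S ** S = A"
  shows "matrix_sqrt A = S"
  unfolding matrix_sqrt_def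
proof (rule the_equality)
  obtain c where c: "c > 0" "\<And>x. c * (x \<bullet> x) \<le> x \<bullet> (S *v x)"
    using assms(2) by (auto simp: posdef_def)
  have "0 \<le> x \<bullet> (S *v x)" for x
    using c(1) c(2)[of x] by (meson inner_ge_zero less_imp_le mult_nonneg_nonneg order_trans)
  then show "pos_semidef S \<and> S ** S = A" using assms by (simp add: pos_semidef_def)
  fix T assume T: "pos_semidef T \<and> T ** T = A"
  have "c * norm (T - S) \<le> norm (T ** T - S ** S)"
    using c(2) T by (intro sqrt_lipschitz) (auto simp: pos_semidef_def)
  then show "T = S" using T assms(3) c(1) by (simp add: mult_le_0_iff)
qed

lemma matrix_sqrt_posdef:
  assumes "transpose A = A" "posdef A"
  shows "transpose (matrix_sqrt A) = matrix_sqrt A" "posdef (matrix_sqrt A)"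
    "matrix_sqrt A ** matrix_sqrt A = A"
  using posdef_sqrt_exists[OF assms] matrix_sqrt_eqI by (metis)+

text \<open>The function \<open>matrix_sqrt\<close> is meaningful on symmetric matrices only, and these do not form an open set in general.
  Composing it with the symmetric part extends it to the open set of positive definite matrices.\<close>

definition sym_part :: "real^'r^'r \<Rightarrow> real^'r^'r" where
  "sym_part A = (1/2) *\<^sub>R (A + transpose A)"

lemma bounded_linear_sym_part: "bounded_linear sym_part"
  unfolding sym_part_def
  by (intro bounded_linear_scaleR_right[THEN bounded_linear_compose] bounded_linear_add
      bounded_linear_ident bounded_linear_transpose)

lemma transpose_sym_part: "transpose (sym_part A) = sym_part A"
  by (simp add: sym_part_def transpose_simps add.commute)

lemma sym_part_symmetric: "transpose A = A \<Longrightarrow> sym_part A = A"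
  by (simp add: sym_part_def scaleR_2[symmetric])

lemma posdef_sym_part: "posdef (sym_part A) \<longleftrightarrow> posdef A"
proof -
  have "x \<bullet> (sym_part A *v x) = x \<bullet> (A *v x)" for x
    by (simp add: sym_part_def scaleR_matrix_vector_assoc[symmetric] matrix_vector_mult_add_rdistrib
        inner_add_right transpose_quadratic_form del: transpose_matrix_vector)
  then show ?thesis by (simp add: posdef_def)
qed

text \<open>The operator \<open>X \<mapsto> S X + X S\<close> is the derivative of squaring at \<open>S\<close>; its invertibility makes
  the square root differentiable.\<close>

lemma lyapunov_injective:
  fixes S X :: "real^'r^'r"
  assumes "posdef S" "S ** X + X ** S = 0"
  shows "X = 0"
proof -
  obtain c where c: "c > 0" "\<And>x. c * (x \<bullet> x) \<le> x \<bullet> (S *v x)"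
    using assms(1) by (auto simp: posdef_def)
  have "c * (X \<bullet> X) \<le> X \<bullet> (S ** X)" "c * (X \<bullet> X) \<le> X \<bullet> (X ** S)"
    using c(2) by (auto intro: inner_mult_left_ge inner_mult_right_ge)
  moreover have "X \<bullet> (S ** X) + X \<bullet> (X ** S) = 0"
    using assms(2) by (simp add: inner_add_right[symmetric])
  ultimately have "c * (X \<bullet> X) \<le> 0" by simp
  then show ?thesis using c(1) by (simp add: mult_le_0_iff inner_self_le_0_iff)
qed

lemma bounded_bilinear_lyapunov:
  "bounded_bilinear (\<lambda>S X :: real^'r^'r. S ** X + X ** S)"
  by (simp add: bilinear_conv_bounded_bilinear[symmetric] bilinear_def linear_iff matrix_distribs
      scaleR_add_right)

lemma sqrt_sym_part:
  assumes "posdef A"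
  defines "S \<equiv> matrix_sqrt (sym_part A)"
  shows "transpose S = S" "posdef S" "S ** S = sym_part A"
  unfolding S_def using assms(1)
  by (auto intro!: matrix_sqrt_posdef simp: transpose_sym_part posdef_sym_part)

text \<open>If the root changes by \<open>D\<close>, its square changes by \<open>S D + D S + D D\<close>. By the Lipschitz estimate
  \<open>D D\<close> is of second order, so the derivative of the root is the inverse \<open>g\<close> of the Lyapunov operator.\<close>

lemma has_derivative_sqrt_sym_part:
  fixes A :: "real^'r^'r"
  defines "S \<equiv> matrix_sqrt (sym_part A)"
  assumes A: "posdef A" and g: "linear g" "\<And>X. g (S ** X + X ** S) = X"
  shows "((\<lambda>B. matrix_sqrt (sym_part B)) has_derivative (\<lambda>v. g (sym_part v))) (at A)"
proof -
  interpret sym: bounded_linear "sym_part :: real^'r^'r \<Rightarrow> _" by (rule bounded_linear_sym_part)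
  interpret g: linear g by (rule g)
  interpret mult: bounded_bilinear "(**) :: real^'r^'r \<Rightarrow> real^'r^'r \<Rightarrow> real^'r^'r"
    by (rule bounded_bilinear_matrix_mult)
  have bg: "bounded_linear g" using g(1) linear_conv_bounded_linear by blast
  let ?D = "\<lambda>B. matrix_sqrt (sym_part B) - S"
  note S = sqrt_sym_part[OF A, folded S_def]
  obtain c where c: "c > 0" "\<And>x. c * (x \<bullet> x) \<le> x \<bullet> (S *v x)"
    using S(2) by (auto simp: posdef_def)
  obtain K where K: "K > 0" "\<And>(X :: real^'r^'r) (Y :: real^'r^'r). norm (X ** Y) \<le> norm X * norm Y * K"
    using mult.pos_bounded by blast
  obtain N where N: "N > 0" "\<forall>X :: real^'r^'r. norm (sym_part X) \<le> norm X * N"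
    using sym.pos_bounded by (elim exE conjE) (rule that)
  have "((\<lambda>B. ?D B ** ?D B) has_derivative (\<lambda>v. 0)) (at A)"
  proof (rule has_derivative_zero_quadratic[OF open_posdef])
    fix B :: "real^'r^'r" assume "B \<in> {B. posdef B}"
    then have B: "posdef B" by simp
    note T = sqrt_sym_part[OF B]
    obtain d where d: "d > 0" "\<And>x. d * (x \<bullet> x) \<le> x \<bullet> (matrix_sqrt (sym_part B) *v x)"
      using T(2) by (auto simp: posdef_def)
    have "0 \<le> x \<bullet> (matrix_sqrt (sym_part B) *v x)" for x
      using d(1) d(2)[of x] by (meson inner_ge_zero less_imp_le mult_nonneg_nonneg order_trans)
    then have "c * norm (?D B) \<le> norm (sym_part B - sym_part A)"
      using sqrt_lipschitz[OF c(2), of "matrix_sqrt (sym_part B)"] by (simp add: T(3) S(3))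
    also have "\<dots> \<le> norm (B - A) * N" unfolding sym.diff[symmetric] by (simp add: N)
    finally have *: "norm (?D B) \<le> norm (B - A) * N / c" using c(1) by (simp add: field_simps)
    have "norm (?D B ** ?D B) \<le> norm (?D B) * norm (?D B) * K" by (simp add: K)
    also have "\<dots> \<le> (norm (B - A) * N / c) * (norm (B - A) * N / c) * K"
      using * K(1) N(1) c(1) by (intro mult_mono) auto
    finally show "norm (?D B ** ?D B) \<le> (N / c * (N / c) * K) * (norm (B - A))\<^sup>2"
      by (simp add: power2_eq_square mult_ac)
  qed (use A in simp)
  then have "((\<lambda>B. S + (g (sym_part (B - A)) - g (?D B ** ?D B))) has_derivative
      (\<lambda>v. 0 + (g (sym_part (v - 0)) - g 0))) (at A)"
    by (intro has_derivative_add has_derivative_const has_derivative_diff has_derivative_ident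
        bounded_linear.has_derivative[OF bg] bounded_linear.has_derivative[OF bounded_linear_sym_part])
  then have der: "((\<lambda>B. S + (g (sym_part (B - A)) - g (?D B ** ?D B))) has_derivative
      (\<lambda>v. g (sym_part v))) (at A)"
    by (simp add: g.zero)
  show ?thesis
  proof (rule has_derivative_transform_within_open[OF der open_posdef])
    fix B :: "real^'r^'r" assume "B \<in> {B. posdef B}"
    then have B: "posdef B" by simp
    note T = sqrt_sym_part[OF B]
    have "sym_part (B - A) - ?D B ** ?D B = S ** ?D B + ?D B ** S"
      by (simp add: sym.diff matrix_distribs T(3) S(3))
    then have "g (sym_part (B - A)) - g (?D B ** ?D B) = ?D B"
      using g(2) by (simp add: g.diff[symmetric])
    then show "S + (g (sym_part (B - A)) - g (?D B ** ?D B)) = matrix_sqrt (sym_part B)"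
      by simp
  qed (use A in simp)
qed

text \<open>The derivative of the root at \<open>A\<close> is a smooth function of the root at \<open>A\<close>: the solution of a Lyapunov
  equation depends smoothly on its coefficient. Hence each order of differentiability implies
  the next.\<close>

lemma smooth_on_open_sqrt_sym_part:
  "smooth_on_open (\<lambda>A. matrix_sqrt (sym_part A)) {A :: real^'r^'r. posdef A}"
proof -
  let ?L = "\<lambda>S X :: real^'r^'r. S ** X + X ** S"
  have lin: "linear (?L S)" for S
    using bounded_bilinear.bounded_linear_right[OF bounded_bilinear_lyapunov] bounded_linear.linear
    by blast
  have inj: "inj (?L S)" if "posdef S" for S
    using lyapunov_injective[OF that] linear_injective_0[OF lin] by blast
  have "\<exists>g. linear g \<and> g \<circ> ?L S = id" if "posdef S" for S
    using linear_injective_left_inverse[OF lin inj[OF that]] by blast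
  then obtain g where g: "\<And>S. posdef S \<Longrightarrow> linear (g S)" "\<And>S X. posdef S \<Longrightarrow> g S (?L S X) = X"
    unfolding o_def fun_eq_iff id_def by metis
  have Lg: "?L S (g S Y) = Y" if S: "posdef S" for S Y
  proof -
    have "surj (?L S)" by (rule linear_injective_imp_surjective[OF lin inj[OF S]]) simp
    then obtain X where "Y = ?L S X" using surjD[of "?L S" Y] by blast
    then show ?thesis using g(2)[OF S] by simp
  qed
  have D: "((\<lambda>B. matrix_sqrt (sym_part B)) has_derivative
      (\<lambda>v. g (matrix_sqrt (sym_part A)) (sym_part v))) (at A)" if "posdef A" for A :: "real^'r^'r"
    using g sqrt_sym_part(2)[OF that] by (intro has_derivative_sqrt_sym_part[OF that])
  have "Ck_on k (\<lambda>A. matrix_sqrt (sym_part A)) {A :: real^'r^'r. posdef A}" for k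
  proof (induction k)
    case 0
    have "continuous_on {A :: real^'r^'r. posdef A} (\<lambda>A. matrix_sqrt (sym_part A))"
      by (intro continuous_at_imp_continuous_on ballI)
        (use D has_derivative_continuous in blast)
    then show ?case by simp
  next
    case (Suc k)
    show ?case
    proof (rule Ck_on_SucI[OF open_posdef D])
      fix v :: "real^'r^'r"
      have "Ck_on k (\<lambda>S. g S (sym_part v)) {S. posdef S}"
        by (rule Ck_on_linear_solution[OF bounded_bilinear_lyapunov open_posdef _ Ck_on_const])
          (auto intro: lyapunov_injective simp: Lg)
      then show "Ck_on k (\<lambda>A. g (matrix_sqrt (sym_part A)) (sym_part v)) {A. posdef A}"
        by (intro Ck_on_compose[OF open_posdef open_posdef _ Suc]) (auto simp: sqrt_sym_part)
    qed simp
  qed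
  then show ?thesis by (simp add: smooth_on_open_def open_posdef)
qed

lemma smooth_map_on_matrix_sqrt [smooth_intros]:
  fixes f :: "'a::euclidean_space \<Rightarrow> real^'r^'r"
  assumes "smooth_map_on S f" "\<And>x. x \<in> S \<Longrightarrow> posdef (f x)" "\<And>x. x \<in> S \<Longrightarrow> transpose (f x) = f x"
  shows "smooth_map_on S (\<lambda>x. matrix_sqrt (f x))"
proof (rule smooth_map_on_cong)
  show "smooth_map_on S (\<lambda>x. matrix_sqrt (sym_part (f x)))"
    by (rule smooth_map_on_compose[OF assms(1)
        smooth_on_open_imp_smooth_map_on[OF smooth_on_open_sqrt_sym_part subset_refl]])
      (use assms(2) in auto)
qed (simp add: assms sym_part_symmetric)


section \<open>Orthonormal frames and projections\<close>

lemma inner_matrix_vector_transpose: "(A *v x) \<bullet> y = x \<bullet> (transpose A *v (y :: real^'m))"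
  by (metis dot_lmul_matrix transpose_matrix_vector transpose_transpose)

lemma matrix_mult_linear:
  fixes f :: "real^'n \<Rightarrow> real^'m"
  shows "linear f \<Longrightarrow> matrix f *v x = f x"
  by (simp add: matrix_works)

lemma Stiefel_iff_norm: "V \<in> Stiefel \<longleftrightarrow> (\<forall>x. norm ((V :: real^'r^'n) *v x) = norm x)"
proof
  assume "V \<in> Stiefel"
  then have "(V *v x) \<bullet> (V *v x) = x \<bullet> x" for x
    by (simp add: Stiefel_def inner_matrix_vector_transpose matrix_vector_mul_assoc
        del: transpose_matrix_vector)
  then show "\<forall>x. norm (V *v x) = norm x" by (simp add: norm_eq_sqrt_inner)
next
  assume n: "\<forall>x. norm (V *v x) = norm x"
  have "x \<bullet> ((transpose V ** V) *v y) = x \<bullet> y" for x y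
  proof -
    have "(V *v x) \<bullet> (V *v y) = x \<bullet> y"
      using n[rule_format, of "x + y"] n by (simp add: dot_norm matrix_vector_right_distrib)
    then show ?thesis
      by (simp add: inner_matrix_vector_transpose matrix_vector_mul_assoc del: transpose_matrix_vector)
  qed
  then have "\<forall>x. x \<bullet> ((transpose V ** V) *v y) = x \<bullet> y" for y
    by (rule allI)
  then have "(transpose V ** V) *v y = y" for y
    by (simp only: vector_eq_ldot)
  then show "V \<in> Stiefel" unfolding Stiefel_def by (simp add: matrix_eq)
qed

lemma StiefelD: "V \<in> Stiefel \<Longrightarrow> transpose V ** V = mat 1"
  by (simp add: Stiefel_def)

lemma Stiefel_cancel: "V \<in> Stiefel \<Longrightarrow> A ** transpose V ** V = A"
  by (simp add: matrix_mul_assoc[symmetric] StiefelD)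

lemma Stiefel_cancel_left: "V \<in> Stiefel \<Longrightarrow> transpose V ** (V ** A) = A"
  by (simp add: matrix_mul_assoc StiefelD)

lemma dim_range_Stiefel:
  fixes V :: "real^'r^'n"
  assumes "V \<in> Stiefel"
  shows "dim (range ((*v) V)) = CARD('r)"
proof -
  have "inj ((*v) V)"
    using matrix_left_invertible_injective StiefelD[OF assms] by blast
  then show ?thesis using full_rank_injective rank_dim_range by metis
qed

lemma subspace_range_matrix: "subspace (range ((*v) (A :: real^'n^'m)))"
  by (simp add: linear_subspace_image)

text \<open>The ranges of complementary orthogonal projections are orthogonal and span the space.\<close>

lemma dim_range_complementary:
  fixes G :: "real^'n^'n"
  assumes "transpose G = G" "G ** G = G"
  shows "dim (range ((*v) G)) + dim (range ((*v) (mat 1 - G))) = CARD('n)"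
proof -
  let ?A = "range ((*v) G)" and ?B = "range ((*v) (mat 1 - G))"
  have "(G *v x) \<bullet> ((mat 1 - G) *v y) = x \<bullet> ((transpose G ** (mat 1 - G)) *v y)" for x y
    by (simp add: inner_matrix_vector_transpose matrix_vector_mul_assoc del: transpose_matrix_vector)
  then have "dim (?A \<union> ?B) = dim ?A + dim ?B"
    by (intro dim_orthogonal_sum) (auto simp: assms matrix_diff_right)
  moreover have "x \<in> span (?A \<union> ?B)" for x
  proof -
    have "x = G *v x + (mat 1 - G) *v x" by (simp add: matrix_vector_mult_diff_rdistrib)
    moreover have "\<dots> \<in> span (?A \<union> ?B)" by (intro span_add span_base) auto
    ultimately show ?thesis by simp
  qed
  then have "span (?A \<union> ?B) = UNIV" by blast
  then have "dim (?A \<union> ?B) = CARD('n)"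
    by (metis dim_span dim_UNIV DIM_cart DIM_real mult.right_neutral)
  ultimately show ?thesis by simp
qed

text \<open>The orthonormal bases, written as matrices of columns, of the subspace onto which \<open>mat 1 - G\<close> projects.\<close>

definition frames :: "real^'n^'n \<Rightarrow> (real^'r^'n) set" where
  "frames G = {V. V \<in> Stiefel \<and> V ** transpose V = mat 1 - G}"

lemma Stiefel_complement:
  fixes V :: "real^'r^'n"
  assumes "V \<in> Stiefel"
  shows "mat 1 - V ** transpose V \<in> Grassmann (CARD('n) - CARD('r))"
proof -
  let ?G = "mat 1 - V ** transpose V"
  have sym: "transpose ?G = ?G" by (simp add: transpose_simps)
  have idem: "?G ** ?G = ?G"
    by (simp add: matrix_distribs matrix_mul_assoc Stiefel_cancel[OF assms])
  have "range ((*v) (V ** transpose V)) = range ((*v) V)"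
  proof safe
    show "(V ** transpose V) *v x \<in> range ((*v) V)" for x
      by (simp add: matrix_vector_mul_assoc[symmetric])
    have "V *v x = (V ** transpose V) *v (V *v x)" for x
      by (simp only: matrix_vector_mul_assoc Stiefel_cancel[OF assms])
    then show "V *v x \<in> range ((*v) (V ** transpose V))" for x by (metis rangeI)
  qed
  then have "rank ?G + CARD('r) = CARD('n)"
    using dim_range_complementary[OF sym idem] dim_range_Stiefel[OF assms] by (simp add: rank_dim_range)
  then show ?thesis using sym idem by (simp add: Grassmann_def)
qed

lemma frames_range:
  fixes V :: "real^'r^'n"
  shows "V \<in> Stiefel \<Longrightarrow> V \<in> frames (mat 1 - V ** transpose V)"
  by (simp add: frames_def)

lemma dim_range_Grassmann:
  fixes G :: "real^'n^'n"
  assumes "G \<in> Grassmann (CARD('n) - r)" "r \<le> CARD('n)"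
  shows "dim (range ((*v) (mat 1 - G))) = r"
  using dim_range_complementary[of G] assms by (simp add: Grassmann_def rank_dim_range)

text \<open>The condition \<open>G ** W = 0\<close> puts the range of \<open>W\<close> inside that of \<open>mat 1 - G\<close>. Both have dimension
  \<open>CARD('r)\<close>, so they agree, and with them the orthogonal projections onto them.\<close>

lemma Grassmann_annihilates_frame:
  fixes W :: "real^'r^'n"
  assumes G: "G \<in> Grassmann (CARD('n) - CARD('r))" and W: "W \<in> Stiefel" and GW: "G ** W = 0"
  shows "W \<in> frames G"
proof -
  let ?P = "mat 1 - G"
  have sym: "transpose ?P = ?P" using G by (simp add: Grassmann_def transpose_simps)
  have PW: "?P ** W = W" using GW by (simp add: matrix_distribs)
  have "range ((*v) W) \<subseteq> range ((*v) ?P)"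
  proof safe
    fix x
    have "W *v x = ?P *v (W *v x)" by (simp only: matrix_vector_mul_assoc PW)
    then show "W *v x \<in> range ((*v) ?P)" by (metis rangeI)
  qed
  moreover have "CARD('r) \<le> CARD('n)"
    using dim_range_Stiefel[OF W] dim_subset_UNIV_cart by metis
  ultimately have "range ((*v) W) = range ((*v) ?P)"
    using dim_range_Grassmann[OF G] dim_range_Stiefel[OF W]
    by (intro subspace_dim_equal subspace_range_matrix) auto
  then have ex: "\<exists>y. ?P *v x = W *v y" for x by (auto simp: set_eq_iff image_iff)
  have "(W ** transpose W) *v (?P *v x) = ?P *v x" for x
  proof -
    obtain y where y: "?P *v x = W *v y" using ex by blast
    show ?thesis
      by (simp only: y matrix_vector_mul_assoc Stiefel_cancel[OF W])
  qed
  then have "W ** transpose W ** ?P = ?P"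
    by (simp add: matrix_eq matrix_vector_mul_assoc)
  then have "transpose (W ** transpose W ** ?P) = ?P" by (simp add: sym)
  then have "?P ** W ** transpose W = ?P" by (simp add: matrix_transpose_mul sym matrix_mul_assoc)
  then show ?thesis using W by (simp add: PW frames_def)
qed

lemma frames_nonempty:
  fixes G :: "real^'n^'n"
  assumes G: "G \<in> Grassmann (CARD('n) - CARD('r))" and le: "CARD('r::finite) \<le> CARD('n)"
  shows "\<exists>V. V \<in> (frames G :: (real^'r^'n) set)"
proof -
  let ?P = "mat 1 - G"
  have d: "dim (UNIV :: (real^'r) set) = dim (range ((*v) ?P))"
    using dim_range_Grassmann[OF G le] by simp
  obtain f :: "real^'r \<Rightarrow> real^'n" where f: "linear f" "f ` UNIV = range ((*v) ?P)" "\<And>x. norm (f x) = norm x"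
    by (rule isometry_subspaces[OF subspace_UNIV subspace_range_matrix d]) (rule that, assumption, assumption, simp)
  have V: "matrix f *v x = f x" for x using f(1) by (simp add: matrix_works)
  have "matrix f \<in> Stiefel" using f(3) by (simp add: Stiefel_iff_norm V)
  moreover have "G ** matrix f = 0"
  proof -
    have "G ** ?P = 0" using G by (simp add: Grassmann_def matrix_distribs)
    moreover have "\<exists>y. f x = ?P *v y" for x
      using f(2) by (auto simp: image_iff set_eq_iff)
    ultimately have "G *v f x = 0" for x
      by (metis matrix_vector_mul_assoc matrix_vector_mult_0)
    then have "(G ** matrix f) *v x = 0" for x
      by (simp only: matrix_vector_mul_assoc[symmetric] V)
    then show ?thesis by (simp add: matrix_eq)
  qed
  ultimately show ?thesis using Grassmann_annihilates_frame[OF G] by blast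
qed

lemma framesD:
  fixes V :: "real^'r^'n"
  assumes "V \<in> frames G"
  shows "V \<in> Stiefel" "V ** transpose V = mat 1 - G" "G = mat 1 - V ** transpose V" "G ** V = 0"
proof -
  show "V \<in> Stiefel" "V ** transpose V = mat 1 - G" using assms by (auto simp: frames_def)
  then show G: "G = mat 1 - V ** transpose V" by simp
  show "G ** V = 0"
    unfolding G using \<open>V \<in> Stiefel\<close> by (simp add: matrix_distribs Stiefel_cancel)
qed

text \<open>The map \<open>J x \<mapsto> V x\<close> is completed by any linear isometry between the orthogonal complements of
  the two ranges, which have the same dimension.\<close>

lemma orthogonal_matrix_between_frames:
  fixes V J :: "real^'r^'n"
  assumes V: "V \<in> Stiefel" and J: "J \<in> Stiefel"
  shows "\<exists>Q. orthogonal_matrix Q \<and> Q ** J = V"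
proof -
  let ?S = "mat 1 - J ** transpose J" and ?T = "mat 1 - V ** transpose V"
  have "rank ?S = rank ?T"
    using Stiefel_complement[OF V] Stiefel_complement[OF J] by (simp add: Grassmann_def)
  then have d: "dim (range ((*v) ?S)) = dim (range ((*v) ?T))" by (simp add: rank_dim_range)
  obtain f where f: "linear f" "f ` range ((*v) ?S) = range ((*v) ?T)"
      "\<And>x. x \<in> range ((*v) ?S) \<Longrightarrow> norm (f x) = norm x"
    by (rule isometry_subspaces[OF subspace_range_matrix subspace_range_matrix d]) (rule that)
  define Q where "Q = V ** transpose J + matrix f ** ?S"
  have Qx: "Q *v x = V *v (transpose J *v x) + f (?S *v x)" for x
    by (simp only: Q_def matrix_vector_mult_add_rdistrib matrix_vector_mul_assoc[symmetric]
        matrix_mult_linear[OF f(1)])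
  have split: "(norm x)\<^sup>2 = (norm (transpose J *v x))\<^sup>2 + (norm (?S *v x))\<^sup>2" for x
  proof -
    have "x = J *v (transpose J *v x) + ?S *v x"
      by (simp add: matrix_vector_mult_diff_rdistrib matrix_vector_mul_assoc del: transpose_matrix_vector)
    moreover have "orthogonal (J *v (transpose J *v x)) (?S *v x)"
    proof -
      have "transpose J ** ?S = 0" by (simp add: matrix_distribs matrix_mul_assoc StiefelD[OF J])
      then show ?thesis
        unfolding orthogonal_def inner_matrix_vector_transpose[of J]
        by (simp add: matrix_vector_mul_assoc del: transpose_matrix_vector)
    qed
    ultimately have "(norm x)\<^sup>2 = (norm (J *v (transpose J *v x)))\<^sup>2 + (norm (?S *v x))\<^sup>2"
      using norm_add_Pythagorean by metis
    then show ?thesis using J by (simp add: Stiefel_iff_norm)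
  qed
  have "norm (Q *v x) = norm x" for x
  proof -
    obtain y where y: "f (?S *v x) = ?T *v y" using f(2) by (metis imageI rangeE rangeI)
    have "transpose V ** ?T = 0" by (simp add: matrix_distribs matrix_mul_assoc StiefelD[OF V])
    then have "orthogonal (V *v (transpose J *v x)) (f (?S *v x))"
      unfolding y orthogonal_def inner_matrix_vector_transpose[of V]
      by (simp add: matrix_vector_mul_assoc del: transpose_matrix_vector)
    then have "(norm (Q *v x))\<^sup>2 = (norm (V *v (transpose J *v x)))\<^sup>2 + (norm (f (?S *v x)))\<^sup>2"
      unfolding Qx by (rule norm_add_Pythagorean)
    also have "\<dots> = (norm x)\<^sup>2"
      using V f(3)[of "?S *v x"] split[of x] by (simp add: Stiefel_iff_norm)
    finally show ?thesis by (simp add: power2_eq_iff_nonneg)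
  qed
  then have "Q \<in> Stiefel" by (simp add: Stiefel_iff_norm)
  then have "orthogonal_matrix Q" by (simp add: orthogonal_matrix Stiefel_def)
  moreover have "Q ** J = V"
    unfolding Q_def using J
    by (simp add: matrix_add_left matrix_mul_assoc[symmetric] StiefelD matrix_diff_left)
  ultimately show ?thesis by blast
qed

text \<open>Polar orthonormalization of the projection of a fixed frame \<open>V0\<close> onto the range of
  \<open>mat 1 - G\<close>. As long as the Gram matrix is positive definite, it depends smoothly on \<open>G\<close>.\<close>

definition gram :: "real^'r^'n \<Rightarrow> real^'n^'n \<Rightarrow> real^'r^'r" where
  "gram V0 G = transpose V0 ** (mat 1 - G) ** V0"

definition polar_frame :: "real^'r^'n \<Rightarrow> real^'n^'n \<Rightarrow> real^'r^'n" where
  "polar_frame V0 G = (mat 1 - G) ** V0 ** matrix_inv (matrix_sqrt (gram V0 G))"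

lemma transpose_matrix_inv:
  fixes A :: "real^'n^'n"
  assumes "invertible A"
  shows "transpose (matrix_inv A) = matrix_inv (transpose A)"
proof -
  have "transpose A ** transpose (matrix_inv A) = mat 1"
    by (simp add: matrix_transpose_mul[symmetric] matrix_inv_mult assms)
  then show ?thesis using matrix_inv_unique by metis
qed

lemma transpose_gram: "transpose G = G \<Longrightarrow> transpose (gram V0 G) = gram V0 G"
  by (simp add: gram_def transpose_simps matrix_mul_assoc)

text \<open>The second claim distinguishes the polar factor from other orthonormalizations: along a curve
  starting at \<open>V0\<close> it forces the velocity of the frame to be orthogonal to the range of \<open>V0\<close>.\<close>

lemma polar_frame:
  fixes V0 :: "real^'r^'n"
  assumes G: "G \<in> Grassmann (CARD('n) - CARD('r))" and pd: "posdef (gram V0 G)"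
  shows "polar_frame V0 G \<in> frames G"
    and "transpose (transpose V0 ** polar_frame V0 G) = transpose V0 ** polar_frame V0 G"
proof -
  let ?P = "mat 1 - G" and ?W = "polar_frame V0 G"
  define S where "S = matrix_sqrt (gram V0 G)"
  have G': "transpose G = G" "G ** G = G" using G by (auto simp: Grassmann_def)
  have P: "transpose ?P = ?P" "?P ** ?P = ?P" "G ** ?P = 0"
    using G' by (simp_all add: transpose_simps matrix_distribs)
  note S = matrix_sqrt_posdef[OF transpose_gram[OF G'(1)] pd, folded S_def]
  have inv: "invertible S" using S(2) by (rule posdef_imp_invertible)
  note SI = matrix_inv_mult[OF inv]
  have tSI: "transpose (matrix_inv S) = matrix_inv S" using transpose_matrix_inv[OF inv] S(1) by simp
  have "transpose V0 ** ?W = gram V0 G ** matrix_inv S"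
    by (simp add: polar_frame_def gram_def S_def matrix_mul_assoc)
  also have "\<dots> = S" by (simp add: S(3)[symmetric] matrix_mul_assoc[symmetric] SI)
  finally show "transpose (transpose V0 ** ?W) = transpose V0 ** ?W" using S(1) by simp
  have "transpose ?W ** ?W = matrix_inv S ** (transpose V0 ** (?P ** ?P) ** V0) ** matrix_inv S"
    by (simp add: polar_frame_def S_def[symmetric] matrix_transpose_mul tSI P(1) matrix_mul_assoc)
  also have "\<dots> = matrix_inv S ** (S ** S) ** matrix_inv S"
    by (simp add: P(2) S(3) gram_def)
  also have "\<dots> = (matrix_inv S ** S) ** (S ** matrix_inv S)"
    by (simp only: matrix_mul_assoc)
  also have "\<dots> = mat 1" by (simp add: SI)
  finally have W: "?W \<in> Stiefel" by (simp add: Stiefel_def)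
  have "G ** ?W = 0" by (simp add: polar_frame_def matrix_mul_assoc P(3))
  then show "?W \<in> frames G" using Grassmann_annihilates_frame[OF G W] by simp
qed

lemma posdef_mat_1: "posdef (mat 1)"
  unfolding posdef_def by (intro exI[of _ 1]) simp

lemma gram_base: "V \<in> frames G \<Longrightarrow> gram V G = mat 1"
  by (auto simp: gram_def framesD(2)[symmetric] matrix_mul_assoc Stiefel_cancel StiefelD framesD(1))

lemma polar_frame_base: "V \<in> frames G \<Longrightarrow> polar_frame V G = V"
proof -
  assume V: "V \<in> frames G"
  have "matrix_sqrt (mat 1 :: real^'a^'a) = mat 1"
    by (rule matrix_sqrt_eqI) (auto simp: posdef_mat_1)
  moreover have "matrix_inv (mat 1 :: real^'a^'a) = mat 1"
    by (rule matrix_inv_unique) simp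
  ultimately show ?thesis
    using V by (simp add: polar_frame_def gram_base framesD(2)[symmetric] Stiefel_cancel framesD(1))
qed

lemma smooth_map_on_polar_frame:
  fixes V0 :: "real^'r^'n"
  assumes f: "smooth_map_on S f" "\<And>x. x \<in> S \<Longrightarrow> f x \<in> Grassmann (CARD('n) - CARD('r))"
    and pd: "\<And>x. x \<in> S \<Longrightarrow> posdef (gram V0 (f x))"
  shows "smooth_map_on S (\<lambda>x. polar_frame V0 (f x))"
proof -
  have sym: "transpose (gram V0 (f x)) = gram V0 (f x)" if "x \<in> S" for x
    using f(2)[OF that] by (intro transpose_gram) (simp add: Grassmann_def)
  have g: "smooth_map_on S (\<lambda>x. gram V0 (f x))"
    unfolding gram_def by (intro smooth_intros f(1))
  show ?thesis
    unfolding polar_frame_def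
    by (intro smooth_intros f(1) g posdef_imp_invertible matrix_sqrt_posdef(2) sym pd)
qed

text \<open>The matrix \<open>J\<close> has the coordinate vectors selected by \<open>\<iota>\<close> as its columns.\<close>

lemma pad_cols_eq_mult:
  fixes \<iota> :: "'r::finite \<Rightarrow> 'n::finite"
  assumes "inj \<iota>"
  obtains J :: "real^'r^'n" where "J \<in> Stiefel" "\<And>H :: real^'r^'m. pad_cols \<iota> H = H ** transpose J"
proof
  let ?J = "(\<chi> i k. if i = \<iota> k then 1 else 0) :: real^'r^'n"
  show "?J \<in> Stiefel"
  proof -
    have "(\<Sum>i\<in>UNIV. (if i = \<iota> k then 1 else 0) * (if i = \<iota> l then 1 else 0)) = (if k = l then 1 else 0 :: real)" for k l
    proof -
      have "(\<Sum>i\<in>UNIV. (if i = \<iota> k then 1 else 0) * (if i = \<iota> l then 1 else 0)) =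
          (\<Sum>i\<in>UNIV. if i = \<iota> k then if k = l then 1 else 0 else 0 :: real)"
        using inj_eq[OF assms] by (intro sum.cong) auto
      then show ?thesis by simp
    qed
    then show ?thesis
      by (simp add: Stiefel_def vec_eq_iff matrix_matrix_mult_def transpose_def mat_def)
  qed
  show "pad_cols \<iota> H = H ** transpose ?J" for H :: "real^'r^'m"
  proof -
    have "(if j \<in> range \<iota> then H $ i $ inv \<iota> j else 0) = (\<Sum>k\<in>UNIV. H $ i $ k * (if j = \<iota> k then 1 else 0))" for i j
    proof (cases "j \<in> range \<iota>")
      case True
      then obtain l where l: "j = \<iota> l" by blast
      have "(\<Sum>k\<in>UNIV. H $ i $ k * (if j = \<iota> k then 1 else 0)) = (\<Sum>k\<in>UNIV. if k = l then H $ i $ l else 0)"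
        using inj_eq[OF assms] l by (intro sum.cong) auto
      then show ?thesis using l assms by simp
    next
      case False
      then have "j \<noteq> \<iota> k" for k by blast
      then show ?thesis using False by simp
    qed
    then show ?thesis
      by (simp add: pad_cols_def vec_eq_iff matrix_matrix_mult_def transpose_def)
  qed
qed

text \<open>By orthogonal invariance the zero columns may be rotated away: some orthogonal \<open>Q\<close> turns the
  padded matrix into \<open>H ** transpose V\<close>, for every frame \<open>V\<close>.\<close>

lemma mem_H_r_iff:
  fixes V :: "real^'r^'n" and H :: "real^'r^'m"
  assumes "inj \<iota>" "orth_invariant h" "V \<in> Stiefel"
  shows "H \<in> H_r h \<iota> \<longleftrightarrow> h (H ** transpose V) = 0"
proof -
  obtain J :: "real^'r^'n" where J: "J \<in> Stiefel" "\<And>H :: real^'r^'m. pad_cols \<iota> H = H ** transpose J"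
    using pad_cols_eq_mult[OF assms(1)] by blast
  obtain Q where Q: "orthogonal_matrix Q" "Q ** J = V"
    using orthogonal_matrix_between_frames[OF assms(3) J(1)] by blast
  have "H ** transpose V = pad_cols \<iota> H ** transpose Q"
    unfolding Q(2)[symmetric] J(2) by (simp add: matrix_transpose_mul matrix_mul_assoc)
  then have "h (H ** transpose V) = h (pad_cols \<iota> H)"
    using assms(2) Q(1) by (simp add: orth_invariant_def)
  then show ?thesis by (simp add: H_r_def)
qed

section \<open>The Cayley retraction\<close>

lemma cayley_W_skew: "transpose (cayley_W V Vp) = - cayley_W V Vp"
  by (simp add: cayley_W_def transpose_simps matrix_mul_assoc)

lemma skew_quadratic_form:
  fixes W :: "real^'n^'n"
  assumes "transpose W = - W"
  shows "x \<bullet> (W *v x) = 0"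
proof -
  have "x \<bullet> (W *v x) = x \<bullet> ((- W) *v x)"
    using transpose_quadratic_form[of x W] by (simp only: assms)
  also have "\<dots> = - (x \<bullet> (W *v x))"
    by (simp add: matrix_vector_mult_def inner_vec_def sum_negf)
  finally show ?thesis by simp
qed

text \<open>A skew matrix has zero quadratic form, so this matrix is positive definite.\<close>

lemma invertible_cayley: "invertible (mat 1 - (1/2) *\<^sub>R cayley_W V Vp)"
proof (rule posdef_imp_invertible)
  show "posdef (mat 1 - (1/2) *\<^sub>R cayley_W V Vp)"
    unfolding posdef_def
    by (intro exI[of _ 1])
      (simp add: matrix_vector_mult_diff_rdistrib scaleR_matrix_vector_assoc[symmetric]
        inner_diff_right skew_quadratic_form cayley_W_skew)
qed

lemma matrix_inv_mult_rev:
  fixes A B :: "real^'n^'n"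
  assumes "invertible A" "invertible B"
  shows "matrix_inv (A ** B) = matrix_inv B ** matrix_inv A"
proof (rule matrix_inv_unique)
  have "A ** B ** (matrix_inv B ** matrix_inv A) = A ** (B ** matrix_inv B) ** matrix_inv A"
    by (simp only: matrix_mul_assoc)
  then show "A ** B ** (matrix_inv B ** matrix_inv A) = mat 1"
    by (simp add: matrix_inv_mult assms)
qed

lemma cayley_Pi_orthogonal:
  fixes V :: "real^'r^'b"
  shows "transpose (cayley_Pi V Vp) ** cayley_Pi V Vp = mat 1"
proof -
  let ?K = "(1/2) *\<^sub>R cayley_W V Vp"
  let ?A = "mat 1 - ?K" and ?B = "mat 1 + ?K"
  have AT: "transpose ?A = ?B" "transpose ?B = ?A"
    by (simp_all add: transpose_simps cayley_W_skew)
  have A: "invertible ?A" by (rule invertible_cayley)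
  then have B: "invertible ?B" using transpose_invertible[OF A] AT(1) by simp
  have "(mat 1 - K) ** (mat 1 + K) = (mat 1 + K) ** (mat 1 - K)" for K :: "real^'b^'b"
    by (simp add: matrix_distribs)
  then have AB: "?A ** ?B = ?B ** ?A" .
  have "matrix_inv ?B ** matrix_inv ?A = matrix_inv (?A ** ?B)"
    by (rule matrix_inv_mult_rev[OF A B, symmetric])
  also have "\<dots> = matrix_inv ?A ** matrix_inv ?B"
    unfolding AB by (rule matrix_inv_mult_rev[OF B A])
  finally have comm: "matrix_inv ?B ** matrix_inv ?A = matrix_inv ?A ** matrix_inv ?B" .
  have "transpose (cayley_Pi V Vp) ** cayley_Pi V Vp
      = ?A ** (matrix_inv ?B ** matrix_inv ?A) ** ?B"
    by (simp only: cayley_Pi_def matrix_transpose_mul transpose_matrix_inv[OF A] AT matrix_mul_assoc)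
  also have "\<dots> = (?A ** matrix_inv ?A) ** (matrix_inv ?B ** ?B)"
    unfolding comm by (simp only: matrix_mul_assoc)
  finally show ?thesis by (simp add: matrix_inv_mult[OF A] matrix_inv_mult[OF B])
qed

lemma cayley_Pi_0: "cayley_Pi V 0 = mat 1"
proof -
  have "cayley_W V 0 = 0" by (simp add: cayley_W_def transpose_simps)
  then show ?thesis by (simp add: cayley_Pi_def matrix_inv_unique)
qed

lemma R_St_in_Stiefel:
  assumes "V \<in> Stiefel" shows "R_St V Vp \<in> Stiefel"
proof -
  have "transpose (R_St V Vp) ** R_St V Vp
      = transpose V ** (transpose (cayley_Pi V Vp) ** cayley_Pi V Vp) ** V"
    by (simp only: R_St_def matrix_transpose_mul matrix_mul_assoc)
  then show ?thesis using assms by (simp add: cayley_Pi_orthogonal Stiefel_def)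
qed

lemma smooth_map_on_cayley_Pi [smooth_intros]:
  assumes "smooth_map_on S f" "smooth_map_on S g"
  shows "smooth_map_on S (\<lambda>x. cayley_Pi (f x) (g x))"
proof -
  have "smooth_map_on S (\<lambda>x. cayley_W (f x) (g x))"
    unfolding cayley_W_def by (intro smooth_intros assms)
  then show ?thesis
    unfolding cayley_Pi_def by (intro smooth_intros invertible_cayley)
qed

lemma cayley_W_scaleR: "cayley_W V (t *\<^sub>R Vp) = t *\<^sub>R cayley_W V Vp"
  by (simp add: cayley_W_def transpose_simps matrix_distribs scaleR_diff_right)

lemma cayley_W_mult:
  assumes "V \<in> Stiefel" "transpose V ** Vp = 0"
  shows "cayley_W V Vp ** V = Vp"
proof -
  have "transpose Vp ** V = transpose (transpose V ** Vp)" by (simp add: matrix_transpose_mul)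
  then have *: "transpose Vp ** V = 0" by (simp add: assms(2) transpose_0)
  have **: "V ** transpose Vp ** V ** transpose V ** V = 0" "V ** transpose Vp ** V = 0"
    using * by (simp_all add: matrix_mul_assoc[symmetric] StiefelD[OF assms(1)])
  have "V ** transpose V ** Vp = 0" using assms(2) by (simp add: matrix_mul_assoc[symmetric])
  then show ?thesis
    using ** by (simp add: cayley_W_def matrix_distribs matrix_mul_assoc Stiefel_cancel[OF assms(1)])
qed

lemma smooth_map_on_differentiable:
  assumes "smooth_map_on S f" "open S" "x \<in> S"
  shows "f differentiable at x"
  using smooth_map_on_imp_smooth_on_open[OF assms(1,2)] assms(3)
  unfolding smooth_on_open_def by (metis Ck_on.simps(2))

lemma R_St_has_vector_derivative:
  assumes V: "V \<in> Stiefel" "transpose V ** Vp = 0"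
  shows "((\<lambda>t. R_St V (t *\<^sub>R Vp)) has_vector_derivative Vp) (at 0)"
proof -
  let ?Y = "\<lambda>t. R_St V (t *\<^sub>R Vp)" and ?W = "cayley_W V Vp"
  have "smooth_map_on UNIV ?Y"
    unfolding R_St_def by (intro smooth_intros)
  then have "?Y differentiable at 0" by (rule smooth_map_on_differentiable) auto
  then obtain D where D: "(?Y has_vector_derivative D) (at 0)"
    using vector_derivative_works by blast
  have Y0: "R_St V 0 = V" by (simp add: R_St_def cayley_Pi_0)
  \<comment> \<open>The defining equation \<open>(1 - t W / 2) Y(t) = (1 + t W / 2) V\<close>, solved for \<open>Y(t)\<close>.\<close>
  have eq: "?Y t = V + t *\<^sub>R ((1/2) *\<^sub>R (?W ** V + ?W ** ?Y t))" for t
  proof -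
    let ?K = "(1/2) *\<^sub>R cayley_W V (t *\<^sub>R Vp)"
    have "(mat 1 - ?K) ** ?Y t = ((mat 1 - ?K) ** matrix_inv (mat 1 - ?K)) ** (mat 1 + ?K) ** V"
      by (simp only: R_St_def cayley_Pi_def matrix_mul_assoc)
    also have "\<dots> = (mat 1 + ?K) ** V"
      by (simp add: matrix_inv_mult invertible_cayley)
    finally show ?thesis
      by (simp add: matrix_distribs cayley_W_scaleR algebra_simps)
  qed
  have "((\<lambda>t. V + t *\<^sub>R ((1/2) *\<^sub>R (?W ** V + ?W ** ?Y t))) has_vector_derivative
      0 + (0 *\<^sub>R ((1/2) *\<^sub>R (0 + ?W ** D)) + 1 *\<^sub>R ((1/2) *\<^sub>R (?W ** V + ?W ** ?Y 0)))) (at 0)"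
    by (intro has_vector_derivative_add has_vector_derivative_const
        has_vector_derivative_scaleR[of "\<lambda>t. t", OF DERIV_ident]
        bounded_linear.has_vector_derivative[OF bounded_linear_scaleR_right]
        bounded_linear.has_vector_derivative[OF
          bounded_bilinear.bounded_linear_right[OF bounded_bilinear_matrix_mult]] D)
  also have "0 + (0 *\<^sub>R ((1/2) *\<^sub>R (0 + ?W ** D)) + 1 *\<^sub>R ((1/2) *\<^sub>R (?W ** V + ?W ** ?Y 0))) = Vp"
    by (simp add: Y0 cayley_W_mult[OF V] scaleR_2[symmetric])
  finally have der: "((\<lambda>t. V + t *\<^sub>R ((1/2) *\<^sub>R (?W ** V + ?W ** ?Y t))) has_vector_derivative Vp) (at 0)" .
  have "(\<lambda>t. V + t *\<^sub>R ((1/2) *\<^sub>R (?W ** V + ?W ** ?Y t))) = ?Y"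
    using eq[symmetric] by (rule ext)
  then show ?thesis using der by (simp only:)
qed


section \<open>Points and tangent vectors in terms of representations\<close>

definition rep_point :: "real^'r^'m \<Rightarrow> real^'r^'n \<Rightarrow> (real^'n^'m) \<times> (real^'n^'n)" where
  "rep_point H V = (H ** transpose V, mat 1 - V ** transpose V)"

definition rep_tangent ::
  "real^'r^'m \<Rightarrow> real^'r^'n \<Rightarrow> real^'r^'m \<Rightarrow> real^'r^'n \<Rightarrow> (real^'n^'m) \<times> (real^'n^'n)" where
  "rep_tangent H V K Vp =
     (K ** transpose V + H ** transpose Vp, - (Vp ** transpose V) - V ** transpose Vp)"

lemma orthogonal_matrixD:
  assumes "orthogonal_matrix Q"
  shows "A ** Q ** transpose Q = A" "A ** transpose Q ** Q = A"
  using assms by (simp_all add: orthogonal_matrix_def matrix_mul_assoc[symmetric])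

lemma rep_point_mult_orthogonal:
  "orthogonal_matrix Q \<Longrightarrow> rep_point (H ** Q) (V ** Q) = rep_point H V"
  by (simp add: rep_point_def matrix_transpose_mul matrix_mul_assoc orthogonal_matrixD)

lemma rep_tangent_mult_orthogonal:
  "orthogonal_matrix Q \<Longrightarrow> rep_tangent (H ** Q) (V ** Q) (K ** Q) (Vp ** Q) = rep_tangent H V K Vp"
  by (simp add: rep_tangent_def matrix_transpose_mul matrix_mul_assoc orthogonal_matrixD)

text \<open>In particular the pair representing a tangent vector is unique, and a construction given in terms
  of representations may be phrased with the tangent vector and the frame alone.\<close>

lemma rep_tangent_coords:
  assumes V: "V \<in> Stiefel" and Vp: "transpose V ** Vp = 0"
  shows "fst (rep_tangent H V K Vp) ** V = K" "- (snd (rep_tangent H V K Vp) ** V) = Vp"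
proof -
  have "transpose Vp ** V = transpose (transpose V ** Vp)" by (simp add: matrix_transpose_mul)
  then have *: "transpose Vp ** V = 0" by (simp add: Vp transpose_0)
  have "A ** transpose Vp ** V = 0" for A :: "real^'a^'d"
    using * by (simp add: matrix_mul_assoc[symmetric])
  moreover have "A ** transpose Vp ** V = 0" for A :: "real^'a^'b"
    using * by (simp add: matrix_mul_assoc[symmetric])
  ultimately show "fst (rep_tangent H V K Vp) ** V = K" "- (snd (rep_tangent H V K Vp) ** V) = Vp"
    by (simp_all add: rep_tangent_def matrix_distribs Stiefel_cancel[OF V] * matrix_mul_assoc[symmetric] StiefelD[OF V])
qed

lemma frames_related:
  assumes "V \<in> frames G" "V2 \<in> frames G"
  obtains Q where "orthogonal_matrix Q" "V2 = V ** Q"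
proof
  let ?Q = "transpose V ** V2"
  note V = framesD(1,2)[OF assms(1)] and V2 = framesD(1,2)[OF assms(2)]
  have eq: "V ** transpose V = V2 ** transpose V2" using V(2) V2(2) by simp
  have "V ** transpose V ** V2 = V2" unfolding eq by (rule Stiefel_cancel[OF V2(1)])
  then show "V2 = V ** ?Q" by (simp add: matrix_mul_assoc)
  have "transpose ?Q ** ?Q = transpose V2 ** (V ** transpose V) ** V2"
    by (simp add: matrix_transpose_mul matrix_mul_assoc)
  also have "\<dots> = mat 1"
    unfolding eq by (simp add: matrix_mul_assoc StiefelD[OF V2(1)])
  finally show "orthogonal_matrix ?Q" by (simp add: orthogonal_matrix)
qed

lemma M_h_frame:
  fixes V :: "real^'r^'n"
  assumes "inj \<iota>" "orth_invariant h" "(X, G) \<in> M_h h CARD('r)" "V \<in> frames G"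
  shows "X ** V \<in> H_r h \<iota>" "X ** V ** transpose V = X" "rep_point (X ** V) V = (X, G)"
proof -
  have XG: "X ** G = 0" "h X = 0" using assms(3) by (auto simp: M_h_def)
  show X: "X ** V ** transpose V = X"
    by (simp add: matrix_mul_assoc[symmetric] framesD(2)[OF assms(4)] matrix_diff_right XG)
  show "X ** V \<in> H_r h \<iota>"
    unfolding mem_H_r_iff[OF assms(1,2) framesD(1)[OF assms(4)]] X by (rule XG)
  show "rep_point (X ** V) V = (X, G)"
    using framesD(3)[OF assms(4)] by (simp add: rep_point_def X)
qed

lemma rep_point_in_M_h:
  fixes V :: "real^'r^'n"
  assumes "inj \<iota>" "orth_invariant h" "H \<in> H_r h \<iota>" "V \<in> Stiefel"
  shows "rep_point H V \<in> M_h h CARD('r)"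
proof -
  have "h (H ** transpose V) = 0" using assms mem_H_r_iff by blast
  moreover have "H ** transpose V ** (mat 1 - V ** transpose V) = 0"
    by (simp add: matrix_diff_right matrix_mul_assoc Stiefel_cancel[OF assms(4)])
  ultimately show ?thesis
    using Stiefel_complement[OF assms(4)] by (simp add: rep_point_def M_h_def)
qed

lemma tangent_spaceI:
  assumes "0 < e" "smooth_map_on {-e<..<e::real} \<gamma>" "\<And>t. t \<in> {-e<..<e} \<Longrightarrow> \<gamma> t \<in> M" "\<gamma> 0 = x"
    "(\<gamma> has_vector_derivative v) (at 0)"
  shows "v \<in> tangent_space M x"
  unfolding tangent_space_def
  by (intro CollectI exI[of _ \<gamma>] exI[of _ e] conjI smooth_map_on_imp_smooth_on_open)
    (use assms in auto)

lemma tangent_spaceE: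
  assumes "v \<in> tangent_space M x"
  obtains \<gamma> e where "0 < e" "smooth_map_on {-e<..<e::real} \<gamma>" "\<And>t. t \<in> {-e<..<e} \<Longrightarrow> \<gamma> t \<in> M"
    "\<gamma> 0 = x" "(\<gamma> has_vector_derivative v) (at 0)"
proof -
  obtain \<gamma> e where g: "0 < e" "smooth_on_open \<gamma> {-e<..<e::real}" "\<gamma> ` {-e<..<e} \<subseteq> M"
    "\<gamma> 0 = x" "(\<gamma> has_vector_derivative v) (at 0)"
    using assms unfolding tangent_space_def by blast
  show thesis
    by (rule that[OF g(1) smooth_on_open_imp_smooth_map_on[OF g(2) subset_refl] _ g(4,5)])
      (use g(3) in auto)
qed

lemma zero_in_tangent_space:
  assumes "x \<in> M" shows "0 \<in> tangent_space M x"
  by (rule tangent_spaceI[of 1 "\<lambda>t. x"]) (auto intro: smooth_intros assms)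

lemmas vd_mult = bounded_bilinear.has_vector_derivative[OF bounded_bilinear_matrix_mult]
lemmas vd_transpose = bounded_linear.has_vector_derivative[OF bounded_linear_transpose]

lemma has_vector_derivative_unique_local:
  assumes "(f has_vector_derivative a) (at x)" "(g has_vector_derivative b) (at x)"
    "open J" "x \<in> J" "\<And>t. t \<in> J \<Longrightarrow> f t = g t"
  shows "a = b"
  using has_vector_derivative_transform_within_open[OF assms(1,3,4,5)] assms(2)
  by (rule vector_derivative_unique_at)

text \<open>Along a curve in the manifold the polar frame \<open>W(t)\<close> with \<open>W(0) = V\<close> is smooth. Its velocity \<open>D\<close>
  satisfies \<open>V\<^sup>T D = 0\<close>, because \<open>V\<^sup>T W\<close> is symmetric while \<open>W\<^sup>T W = 1\<close> makes \<open>V\<^sup>T D\<close> antisymmetric.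
  Differentiating \<open>G W = 0\<close>, \<open>X = (X W) W\<^sup>T\<close> and \<open>W W\<^sup>T = 1 - G\<close> then identifies \<open>D\<close> with
  \<open>- \<zeta> V\<close> and gives the representation; the curve \<open>X W\<close> shows that \<open>\<eta> V\<close> is tangent to the set
  of the matrices \<open>H\<close>.\<close>

lemma tangent_M_h_coords:
  fixes V :: "real^'r^'n" and h :: "real^'n^'m \<Rightarrow> real^'q"
  assumes h: "inj \<iota>" "orth_invariant h" and V: "V \<in> frames G"
    and tan: "(\<eta>, \<zeta>) \<in> tangent_space (M_h h CARD('r)) (X, G)"
  shows "\<eta> ** V \<in> tangent_space (H_r h \<iota>) (X ** V)" "transpose V ** (\<zeta> ** V) = 0"
    "rep_tangent (X ** V) V (\<eta> ** V) (- (\<zeta> ** V)) = (\<eta>, \<zeta>)"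
proof -
  obtain \<gamma> e where \<gamma>: "0 < e" "smooth_map_on {-e<..<e::real} \<gamma>"
    "\<And>t. t \<in> {-e<..<e} \<Longrightarrow> \<gamma> t \<in> M_h h CARD('r)" "\<gamma> 0 = (X, G)"
    "(\<gamma> has_vector_derivative (\<eta>, \<zeta>)) (at 0)"
    by (rule tangent_spaceE[OF tan]) (rule that)
  let ?I = "{-e<..<e}"
  define Xt where "Xt t = fst (\<gamma> t)" for t
  define Gt where "Gt t = snd (\<gamma> t)" for t
  have smX: "smooth_map_on ?I Xt" and smG: "smooth_map_on ?I Gt"
    unfolding Xt_def Gt_def by (intro smooth_intros \<gamma>)+
  have base: "Xt 0 = X" "Gt 0 = G" by (simp_all add: Xt_def Gt_def \<gamma>(4))
  have dX: "(Xt has_vector_derivative \<eta>) (at 0)" and dG: "(Gt has_vector_derivative \<zeta>) (at 0)"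
    unfolding Xt_def Gt_def
    using bounded_linear.has_vector_derivative[OF bounded_linear_fst \<gamma>(5)]
      bounded_linear.has_vector_derivative[OF bounded_linear_snd \<gamma>(5)] by simp_all
  have mem: "(Xt t, Gt t) \<in> M_h h CARD('r)" if "t \<in> ?I" for t
    using \<gamma>(3)[OF that] by (simp add: Xt_def Gt_def)
  then have gr: "Gt t \<in> Grassmann (CARD('n) - CARD('r))" if "t \<in> ?I" for t
    using that by (auto simp: M_h_def)
  \<comment> \<open>At \<open>t = 0\<close> the Gram matrix is the identity, so the polar frame is available for small \<open>t\<close>.\<close>
  have "smooth_map_on ?I (\<lambda>t. gram V (Gt t))"
    unfolding gram_def by (intro smooth_intros smG)
  then have "open (?I \<inter> (\<lambda>t. gram V (Gt t)) -` {A. posdef A})"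
    by (intro continuous_open_preimage smooth_map_on_imp_continuous_on open_posdef) auto
  moreover have "0 \<in> ?I \<inter> (\<lambda>t. gram V (Gt t)) -` {A. posdef A}"
    using \<gamma>(1) by (simp add: base gram_base[OF V] posdef_mat_1)
  ultimately obtain d where d: "d > 0" "ball 0 d \<subseteq> ?I \<inter> (\<lambda>t. gram V (Gt t)) -` {A. posdef A}"
    using openE by blast
  let ?J = "{-d<..<d}"
  have pd: "posdef (gram V (Gt t))" if "t \<in> ?J" for t
    using d(2) that by (auto simp: subset_iff dist_real_def abs_less_iff)
  have JI: "?J \<subseteq> ?I"
    using d(2) by (auto simp: subset_iff dist_real_def abs_less_iff)
  have J: "open ?J" "0 \<in> ?J" using d(1) by auto
  define W where "W t = polar_frame V (Gt t)" for t
  have smW: "smooth_map_on ?J W"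
    unfolding W_def
    by (intro smooth_map_on_polar_frame smooth_map_on_subset[OF smG JI]) (use gr JI pd in auto)
  have W0: "W 0 = V" by (simp add: W_def base polar_frame_base[OF V])
  have W: "W t \<in> frames (Gt t)" "transpose (transpose V ** W t) = transpose V ** W t" if "t \<in> ?J" for t
    using polar_frame[OF gr pd[OF that]] that JI by (auto simp: W_def)
  obtain D where D: "(W has_vector_derivative D) (at 0)"
    using smooth_map_on_differentiable[OF smW J] vector_derivative_works by blast
  note dWt = vd_transpose[OF D]
  have "transpose (transpose V ** D) = transpose V ** D"
    by (rule has_vector_derivative_unique_local[OF vd_transpose[OF
          bounded_linear.has_vector_derivative[OF
            bounded_bilinear.bounded_linear_right[OF bounded_bilinear_matrix_mult, of "transpose V"] D]]
          bounded_linear.has_vector_derivative[OF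
            bounded_bilinear.bounded_linear_right[OF bounded_bilinear_matrix_mult, of "transpose V"] D] J])
      (rule W(2))
  moreover have "transpose (W 0) ** D + transpose D ** W 0 = 0"
    by (rule has_vector_derivative_unique_local[OF vd_mult[OF dWt D] has_vector_derivative_const J])
      (use W(1) framesD(1) StiefelD in blast)
  ultimately have "transpose V ** D + transpose V ** D = 0"
    by (simp add: W0 matrix_transpose_mul)
  then have VD: "transpose V ** D = 0"
    by (simp add: scaleR_2[symmetric])
  have "Gt 0 ** D + \<zeta> ** W 0 = 0"
    by (rule has_vector_derivative_unique_local[OF vd_mult[OF dG D] has_vector_derivative_const J])
      (use W(1) framesD(4) in blast)
  moreover have "G ** D = D"
    by (subst framesD(3)[OF V]) (simp add: matrix_diff_left matrix_mul_assoc[symmetric] VD)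
  ultimately have "D + \<zeta> ** V = 0" by (simp add: W0 base)
  then have D_eq: "D = - (\<zeta> ** V)" by (simp add: eq_neg_iff_add_eq_0)
  show V\<zeta>: "transpose V ** (\<zeta> ** V) = 0"
    using VD by (simp add: D_eq matrix_distribs)
  have XV: "X ** V ** transpose V = X"
    using M_h_frame(2)[OF h _ V] mem[of 0] \<gamma>(1) by (simp add: base)
  have "X ** D = X ** V ** (transpose V ** D)" using XV by (simp add: matrix_mul_assoc)
  then have XD: "X ** D = 0" by (simp add: VD)
  have dXW: "((\<lambda>t. Xt t ** W t) has_vector_derivative \<eta> ** V) (at 0)"
    using vd_mult[OF dX D] by (simp add: base W0 XD)
  show "\<eta> ** V \<in> tangent_space (H_r h \<iota>) (X ** V)"
  proof (rule tangent_spaceI[OF d(1) _ _ _ dXW])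
    show "smooth_map_on ?J (\<lambda>t. Xt t ** W t)"
      by (intro smooth_intros smW smooth_map_on_subset[OF smX JI])
    show "Xt t ** W t \<in> H_r h \<iota>" if "t \<in> ?J" for t
      using M_h_frame(1)[OF h mem W(1)[OF that]] that JI by blast
  qed (simp add: base W0)
  have "Xt 0 ** W 0 ** transpose D + \<eta> ** V ** transpose (W 0) = \<eta>"
    by (rule has_vector_derivative_unique_local[OF vd_mult[OF dXW dWt] dX J])
      (use M_h_frame(2)[OF h mem W(1)] JI in blast)
  then have 1: "\<eta> ** V ** transpose V + X ** V ** transpose (- (\<zeta> ** V)) = \<eta>"
    by (simp add: base W0 D_eq add.commute)
  have "W 0 ** transpose D + D ** transpose (W 0) = 0 - \<zeta>"
    by (rule has_vector_derivative_unique_local[OF vd_mult[OF D dWt]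
          has_vector_derivative_diff[OF has_vector_derivative_const[of "mat 1"] dG] J])
      (use W(1) framesD(2) in blast)
  then have 2: "- (- (\<zeta> ** V) ** transpose V) - V ** transpose (- (\<zeta> ** V)) = \<zeta>"
    by (simp add: W0 D_eq transpose_simps matrix_distribs algebra_simps)
  show "rep_tangent (X ** V) V (\<eta> ** V) (- (\<zeta> ** V)) = (\<eta>, \<zeta>)"
    using 1 2 by (simp add: rep_tangent_def)
qed

lemma rep_point_has_vector_derivative:
  assumes "(Hc has_vector_derivative K) (at t)" "(Vc has_vector_derivative Vp) (at t)"
  shows "((\<lambda>t. rep_point (Hc t) (Vc t)) has_vector_derivative rep_tangent (Hc t) (Vc t) K Vp) (at t)"
proof -
  note a = vd_mult[OF assms(1) vd_transpose[OF assms(2)]]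
    and b = has_vector_derivative_diff[OF has_vector_derivative_const[of "mat 1"]
      vd_mult[OF assms(2) vd_transpose[OF assms(2)]]]
  show ?thesis
    using has_vector_derivative_Pair[OF a b]
    by (simp add: rep_point_def[abs_def] rep_tangent_def add.commute)
qed

text \<open>A curve through \<open>H\<close> with velocity \<open>K\<close> is combined with the Cayley curve through \<open>V\<close>.\<close>

lemma rep_tangent_in_tangent_space:
  fixes V :: "real^'r^'n" and h :: "real^'n^'m \<Rightarrow> real^'q"
  assumes h: "inj \<iota>" "orth_invariant h" and V: "V \<in> Stiefel" "transpose V ** Vp = 0"
    and K: "K \<in> tangent_space (H_r h \<iota>) H"
  shows "rep_tangent H V K Vp \<in> tangent_space (M_h h CARD('r)) (rep_point H V)"
proof -
  obtain \<gamma> e where \<gamma>: "0 < e" "smooth_map_on {-e<..<e::real} \<gamma>"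
    "\<And>t. t \<in> {-e<..<e} \<Longrightarrow> \<gamma> t \<in> H_r h \<iota>" "\<gamma> 0 = H" "(\<gamma> has_vector_derivative K) (at 0)"
    by (rule tangent_spaceE[OF K]) (rule that)
  let ?V = "\<lambda>t. R_St V (t *\<^sub>R Vp)"
  have V0: "R_St V 0 = V" by (simp add: R_St_def cayley_Pi_0)
  have sm: "smooth_map_on {-e<..<e} ?V" unfolding R_St_def by (intro smooth_intros)
  have der: "((\<lambda>t. rep_point (\<gamma> t) (?V t)) has_vector_derivative rep_tangent H V K Vp) (at 0)"
    using rep_point_has_vector_derivative[OF \<gamma>(5) R_St_has_vector_derivative[OF V]]
    by (simp add: \<gamma>(4) V0)
  show ?thesis
  proof (rule tangent_spaceI[OF \<gamma>(1) _ _ _ der])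
    show "smooth_map_on {-e<..<e} (\<lambda>t. rep_point (\<gamma> t) (?V t))"
      unfolding rep_point_def by (intro smooth_intros \<gamma>(2) sm)
    show "rep_point (\<gamma> t) (?V t) \<in> M_h h CARD('r)" if "t \<in> {-e<..<e}" for t
      by (intro rep_point_in_M_h[OF h \<gamma>(3)[OF that]] R_St_in_Stiefel V)
  qed (simp add: \<gamma>(4) V0)
qed

section \<open>The metric in terms of representations\<close>

lemma inner_mult_adjoint_right: "(A ** B) \<bullet> C = A \<bullet> (C ** transpose B)"
  for A :: "real^'k^'m" and B :: "real^'n^'k"
proof -
  have "(A ** B) \<bullet> C = trace (transpose B ** (transpose A ** C))"
    by (simp add: inner_matrix_eq_trace matrix_transpose_mul matrix_mul_assoc)
  also have "\<dots> = trace (transpose A ** C ** transpose B)" by (rule trace_mul_sym)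
  finally show ?thesis by (simp add: inner_matrix_eq_trace matrix_mul_assoc)
qed

lemma inner_mult_adjoint_left: "(A ** B) \<bullet> C = B \<bullet> (transpose A ** C)"
  for A :: "real^'k^'m" and B :: "real^'n^'k"
  by (simp add: inner_matrix_eq_trace matrix_transpose_mul matrix_mul_assoc)

lemma transpose_M_mat: "transpose (M_mat \<omega> H) = M_mat \<omega> H"
  by (simp add: M_mat_def transpose_simps)

lemma posdef_M_mat:
  assumes "0 < \<omega>" shows "posdef (M_mat \<omega> H)"
  unfolding posdef_def
proof (intro exI[of _ "2 * \<omega>"] conjI allI)
  fix x
  have "x \<bullet> ((transpose H ** H) *v x) = (H *v x) \<bullet> (H *v x)"
    by (simp add: matrix_vector_mul_assoc[symmetric] inner_matrix_vector_transpose del: transpose_matrix_vector)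
  then have "0 \<le> x \<bullet> ((transpose H ** H) *v x)" by simp
  then show "2 * \<omega> * (x \<bullet> x) \<le> x \<bullet> (M_mat \<omega> H *v x)"
    by (simp add: M_mat_def matrix_vector_mult_add_rdistrib scaleR_matrix_vector_assoc[symmetric]
        inner_add_right)
qed (use assms in simp)

lemmas sqrt_M_mat = matrix_sqrt_posdef[OF transpose_M_mat posdef_M_mat]

text \<open>All mixed terms contain the factor \<open>V\<^sup>T V\<^sub>p = 0\<close>. The terms quadratic in \<open>V\<^sub>p\<close> add up to the weight
  \<open>2 \<omega> + H\<^sup>T H\<close>, that is, to \<open>S ** S\<close>.\<close>

lemma metric_rep_tangent:
  fixes H K :: "real^'r^'m" and V Vp :: "real^'r^'n"
  assumes \<omega>: "0 < \<omega>" and V: "V \<in> Stiefel" and Vp: "transpose V ** Vp = 0"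
  defines "S \<equiv> matrix_sqrt (M_mat \<omega> H)"
  shows "metric_M_h \<omega> (rep_tangent H V K Vp) (rep_tangent H V K Vp) = K \<bullet> K + (Vp ** S) \<bullet> (Vp ** S)"
proof -
  have "transpose Vp ** V = transpose (transpose V ** Vp)" by (simp add: matrix_transpose_mul)
  then have VpV: "transpose Vp ** V = 0" by (simp add: Vp transpose_0)
  have "(K ** transpose V) \<bullet> (K ** transpose V) = K \<bullet> K"
    "(Vp ** transpose V) \<bullet> (Vp ** transpose V) = Vp \<bullet> Vp"
    by (simp_all add: inner_mult_adjoint_right Stiefel_cancel[OF V])
  moreover have "(V ** transpose Vp) \<bullet> (V ** transpose Vp) = Vp \<bullet> Vp"
    by (simp add: inner_mult_adjoint_left Stiefel_cancel_left[OF V] inner_transpose_transpose)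
  moreover have "(K ** transpose V) \<bullet> (H ** transpose Vp) = 0"
    "(Vp ** transpose V) \<bullet> (V ** transpose Vp) = 0"
    by (simp_all add: inner_mult_adjoint_right matrix_mul_assoc[symmetric] VpV)
  moreover have "(H ** transpose Vp) \<bullet> (H ** transpose Vp) = Vp \<bullet> (Vp ** (transpose H ** H))"
  proof -
    have "(H ** transpose Vp) \<bullet> (H ** transpose Vp)
        = transpose Vp \<bullet> transpose (Vp ** (transpose H ** H))"
      by (simp add: inner_mult_adjoint_left matrix_transpose_mul matrix_mul_assoc)
    then show ?thesis by (simp add: inner_transpose_transpose)
  qed
  moreover have "(Vp ** S) \<bullet> (Vp ** S) = Vp \<bullet> (Vp ** M_mat \<omega> H)"
    using sqrt_M_mat[OF \<omega>, of H, folded S_def]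
    by (simp add: inner_mult_adjoint_right matrix_mul_assoc[symmetric])
  ultimately show ?thesis
    by (simp add: metric_M_h_def rep_tangent_def M_mat_def matrix_distribs inner_add_left
        inner_add_right inner_diff_left inner_diff_right inner_commute algebra_simps)
qed


section \<open>Transport through a frame\<close>

text \<open>The frame \<open>V\<close> is an auxiliary argument: it is the one in which \<open>p\<close> and the tangent vectors are
  represented.\<close>

definition frame_retraction ::
  "(real^'r^'m \<Rightarrow> real^'r^'m \<Rightarrow> real^'r^'m) \<Rightarrow> real^'r^'n \<Rightarrow>
   (real^'n^'m) \<times> (real^'n^'n) \<Rightarrow> (real^'n^'m) \<times> (real^'n^'n) \<Rightarrow> (real^'n^'m) \<times> (real^'n^'n)" where
  "frame_retraction R_H V p v =
     rep_point (R_H (fst p ** V) (fst v ** V)) (R_St V (- (snd v ** V)))"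

definition weighted_T_St ::
  "real \<Rightarrow> real^'r^'m \<Rightarrow> real^'r^'m \<Rightarrow> real^'r^'n \<Rightarrow> real^'r^'n \<Rightarrow> real^'r^'n \<Rightarrow> real^'r^'n" where
  "weighted_T_St \<omega> H H' V Vp' Vp =
     T_St V Vp' (Vp ** matrix_sqrt (M_mat \<omega> H)) ** matrix_inv (matrix_sqrt (M_mat \<omega> H'))"

definition frame_transport ::
  "real \<Rightarrow> (real^'r^'m \<Rightarrow> real^'r^'m \<Rightarrow> real^'r^'m) \<Rightarrow>
   (real^'r^'m \<Rightarrow> real^'r^'m \<Rightarrow> real^'r^'m \<Rightarrow> real^'r^'m) \<Rightarrow> real^'r^'n \<Rightarrow>
   (real^'n^'m) \<times> (real^'n^'n) \<Rightarrow> (real^'n^'m) \<times> (real^'n^'n) \<Rightarrow> (real^'n^'m) \<times> (real^'n^'n) \<Rightarrow>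
   (real^'n^'m) \<times> (real^'n^'n)" where
  "frame_transport \<omega> R_H T_H V p v' v =
     (let H = fst p ** V; K' = fst v' ** V; H' = R_H H K'; Vp' = - (snd v' ** V)
      in rep_tangent H' (R_St V Vp') (T_H H K' (fst v ** V))
           (weighted_T_St \<omega> H H' V Vp' (- (snd v ** V))))"

lemma cayley_Pi_mult_orthogonal:
  "orthogonal_matrix Q \<Longrightarrow> cayley_Pi (V ** Q) (Vp ** Q) = cayley_Pi V Vp"
  by (simp add: cayley_Pi_def cayley_W_def matrix_transpose_mul matrix_mul_assoc orthogonal_matrixD)

lemma R_St_mult_orthogonal:
  "orthogonal_matrix Q \<Longrightarrow> R_St (V ** Q) (Vp ** Q) = R_St V Vp ** Q"
  by (simp add: R_St_def cayley_Pi_mult_orthogonal matrix_mul_assoc)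

text \<open>Conjugation by \<open>Q\<close> commutes with taking roots, by uniqueness of the root.\<close>

lemma matrix_sqrt_M_mat_mult_orthogonal:
  fixes H :: "real^'r^'m"
  assumes "0 < \<omega>" and Q: "orthogonal_matrix Q"
  defines "S \<equiv> matrix_sqrt (M_mat \<omega> H)"
  shows "matrix_sqrt (M_mat \<omega> (H ** Q)) = transpose Q ** S ** Q"
proof (rule matrix_sqrt_eqI)
  note S = sqrt_M_mat[OF assms(1), of H, folded S_def]
  show "transpose (transpose Q ** S ** Q) = transpose Q ** S ** Q"
    by (simp add: matrix_transpose_mul matrix_mul_assoc S)
  obtain c where c: "c > 0" "\<And>x. c * (x \<bullet> x) \<le> x \<bullet> (S *v x)"
    using S(2) by (auto simp: posdef_def)
  have "c * (x \<bullet> x) \<le> x \<bullet> ((transpose Q ** S ** Q) *v x)" for x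
  proof -
    have "(Q *v x) \<bullet> (Q *v x) = x \<bullet> x"
      using Q by (simp add: inner_matrix_vector_transpose matrix_vector_mul_assoc orthogonal_matrix_def
          del: transpose_matrix_vector)
    moreover have "(Q *v x) \<bullet> (S *v (Q *v x)) = x \<bullet> ((transpose Q ** S ** Q) *v x)"
      unfolding inner_matrix_vector_transpose[of Q]
      by (simp add: matrix_vector_mul_assoc matrix_mul_assoc del: transpose_matrix_vector)
    ultimately show ?thesis using c(2)[of "Q *v x"] by simp
  qed
  then show "posdef (transpose Q ** S ** Q)" using c(1) posdef_def by blast
  have "transpose Q ** S ** Q ** (transpose Q ** S ** Q) = transpose Q ** (S ** S) ** Q"
    by (simp add: matrix_mul_assoc orthogonal_matrixD[OF Q])
  also have "\<dots> = M_mat \<omega> (H ** Q)"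
    using Q unfolding S(3) by (simp add: M_mat_def matrix_transpose_mul matrix_distribs matrix_mul_assoc
        orthogonal_matrix_def)
  finally show "transpose Q ** S ** Q ** (transpose Q ** S ** Q) = M_mat \<omega> (H ** Q)" .
qed

lemma weighted_T_St_mult_orthogonal:
  assumes \<omega>: "0 < \<omega>" and Q: "orthogonal_matrix Q"
  shows "weighted_T_St \<omega> (H ** Q) (H' ** Q) (V ** Q) (Vp' ** Q) (Vp ** Q) = weighted_T_St \<omega> H H' V Vp' Vp ** Q"
proof -
  let ?S' = "matrix_sqrt (M_mat \<omega> H')"
  have inv: "invertible ?S'" using sqrt_M_mat(2)[OF \<omega>] by (rule posdef_imp_invertible)
  have "transpose Q ** ?S' ** Q ** (transpose Q ** matrix_inv ?S' ** Q)
      = transpose Q ** (?S' ** matrix_inv ?S') ** Q"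
    by (simp add: matrix_mul_assoc orthogonal_matrixD[OF Q])
  also have "\<dots> = mat 1"
    using Q by (simp add: matrix_inv_mult[OF inv] orthogonal_matrix_def)
  finally have "matrix_inv (transpose Q ** ?S' ** Q) = transpose Q ** matrix_inv ?S' ** Q"
    by (rule matrix_inv_unique)
  then show ?thesis
    by (simp add: weighted_T_St_def T_St_def matrix_sqrt_M_mat_mult_orthogonal[OF \<omega> Q]
        cayley_Pi_mult_orthogonal[OF Q] matrix_mul_assoc orthogonal_matrixD[OF Q])
qed

text \<open>In the weights of the metric at its two end points the transport is multiplication by an orthogonal
  matrix.\<close>

lemma weighted_T_St_sqrt:
  assumes \<omega>: "0 < \<omega>"
  shows "weighted_T_St \<omega> H H' V Vp' Vp ** matrix_sqrt (M_mat \<omega> H')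
    = cayley_Pi V Vp' ** (Vp ** matrix_sqrt (M_mat \<omega> H))"
  using matrix_inv_mult(2)[OF posdef_imp_invertible[OF sqrt_M_mat(2)[OF \<omega>]], of H']
  by (simp add: weighted_T_St_def T_St_def matrix_mul_assoc[symmetric])

lemma weighted_T_St_normal:
  assumes "transpose V ** Vp = 0"
  shows "transpose (R_St V Vp') ** weighted_T_St \<omega> H H' V Vp' Vp = 0"
proof -
  let ?S = "matrix_sqrt (M_mat \<omega> H)" and ?I = "matrix_inv (matrix_sqrt (M_mat \<omega> H'))"
  have "transpose (R_St V Vp') ** weighted_T_St \<omega> H H' V Vp' Vp
      = transpose V ** (transpose (cayley_Pi V Vp') ** cayley_Pi V Vp') ** Vp ** ?S ** ?I"
    by (simp only: R_St_def weighted_T_St_def T_St_def matrix_transpose_mul matrix_mul_assoc)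
  then show ?thesis by (simp add: cayley_Pi_orthogonal assms)
qed

lemma smooth_map_on_sqrt_M_mat:
  assumes "0 < \<omega>" "smooth_map_on S f"
  shows "smooth_map_on S (\<lambda>x. matrix_sqrt (M_mat \<omega> (f x)))"
proof (rule smooth_map_on_matrix_sqrt)
  show "smooth_map_on S (\<lambda>x. M_mat \<omega> (f x))"
    unfolding M_mat_def by (intro smooth_intros assms(2))
qed (use assms(1) in \<open>auto simp: posdef_M_mat transpose_M_mat\<close>)

lemma rep_tangent_linear:
  "rep_tangent H V (a *\<^sub>R K + b *\<^sub>R L) (a *\<^sub>R Vp + b *\<^sub>R Wp) = a *\<^sub>R rep_tangent H V K Vp + b *\<^sub>R rep_tangent H V L Wp"
  by (simp add: rep_tangent_def transpose_simps matrix_distribs algebra_simps)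

lemma weighted_T_St_linear:
  "weighted_T_St w H H' V Vp' (a *\<^sub>R Vp + b *\<^sub>R Wp) = a *\<^sub>R weighted_T_St w H H' V Vp' Vp + b *\<^sub>R weighted_T_St w H H' V Vp' Wp"
  by (simp add: weighted_T_St_def T_St_def matrix_distribs)

locale compatible_pair =
  fixes h :: "real^'n^'m \<Rightarrow> real^'q" and \<iota> :: "'r::finite \<Rightarrow> 'n" and \<omega> :: real
    and R_H :: "real^'r^'m \<Rightarrow> real^'r^'m \<Rightarrow> real^'r^'m"
    and T_H :: "real^'r^'m \<Rightarrow> real^'r^'m \<Rightarrow> real^'r^'m \<Rightarrow> real^'r^'m"
  assumes inj: "inj \<iota>" and inv: "orth_invariant h" and \<omega>: "0 < \<omega>"
    and iso: "is_isometric_vector_transport (\<bullet>) (H_r h \<iota>) R_H T_H"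
    and homog: "orth_homogeneous (H_r h \<iota>) R_H"
    and compat: "compatible_transport (H_r h \<iota>) T_H"
begin

abbreviation "Hr \<equiv> H_r h \<iota>"

lemma vt: "is_vector_transport Hr R_H T_H"
  using iso by (simp add: is_isometric_vector_transport_def)

lemma R_H:
  assumes "H \<in> Hr" "K \<in> tangent_space Hr H"
  shows "R_H H K \<in> Hr" "R_H H 0 = H" "((\<lambda>t. R_H H (t *\<^sub>R K)) has_vector_derivative K) (at 0)"
  using vt assms by (auto simp: is_vector_transport_def is_retraction_def tangent_bundle_def)

lemma T_H:
  assumes "H \<in> Hr" "K' \<in> tangent_space Hr H" "K \<in> tangent_space Hr H"
  shows "T_H H K' K \<in> tangent_space Hr (R_H H K')" "T_H H 0 K = K"
    "T_H H K' K \<bullet> T_H H K' K = K \<bullet> K"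
  using iso vt assms
  by (auto simp: is_isometric_vector_transport_def is_vector_transport_def
      tangent_bundle_def double_tangent_bundle_def)

lemma T_H_linear:
  assumes "H \<in> Hr" "K' \<in> tangent_space Hr H" "K \<in> tangent_space Hr H" "L \<in> tangent_space Hr H"
  shows "T_H H K' (a *\<^sub>R K + b *\<^sub>R L) = a *\<^sub>R T_H H K' K + b *\<^sub>R T_H H K' L"
  using vt assms unfolding is_vector_transport_def tangent_bundle_def by blast

lemma point_coords:
  assumes "p \<in> (M_h h CARD('r))" "V \<in> frames (snd p)"
  shows "fst p ** V \<in> Hr" "rep_point (fst p ** V) V = p"
  using M_h_frame[OF inj inv, of "fst p" "snd p" V] assms by auto

lemma tangent_coords:
  assumes "p \<in> (M_h h CARD('r))" "V \<in> frames (snd p)" "v \<in> tangent_space (M_h h CARD('r)) p"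
  shows "fst v ** V \<in> tangent_space Hr (fst p ** V)" "transpose V ** - (snd v ** V) = 0"
    "rep_tangent (fst p ** V) V (fst v ** V) (- (snd v ** V)) = v"
  using tangent_M_h_coords[OF inj inv assms(2), of "fst v" "snd v" "fst p"] assms(3)
  by (simp_all add: matrix_minus_right)

text \<open>Passing to another frame multiplies all representing matrices by one orthogonal matrix, with which
  both factor retractions commute and which cancels in \<open>rep_point\<close>.\<close>

lemma frame_retraction_indep:
  assumes p: "p \<in> (M_h h CARD('r))" "v \<in> tangent_space (M_h h CARD('r)) p" and V: "V \<in> frames (snd p)" "V2 \<in> frames (snd p)"
  shows "frame_retraction R_H V2 p v = frame_retraction R_H V p v"
proof -
  obtain Q where Q: "orthogonal_matrix Q" "V2 = V ** Q" using frames_related[OF V] .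
  have "R_H (fst p ** V) (fst v ** V) ** Q = R_H (fst p ** V ** Q) (fst v ** V ** Q)"
    using homog Q(1) point_coords[OF p(1) V(1)] tangent_coords[OF p(1) V(1) p(2)]
    by (auto simp: orth_homogeneous_def tangent_bundle_def)
  then show ?thesis
    using R_St_mult_orthogonal[OF Q(1), of V "- (snd v ** V)"]
    by (simp add: frame_retraction_def Q(2) matrix_mul_assoc matrix_minus_left
        rep_point_mult_orthogonal[OF Q(1), symmetric, of "R_H (fst p ** V) (fst v ** V)"])
qed

lemma frame_transport_indep:
  assumes p: "p \<in> (M_h h CARD('r))" "v' \<in> tangent_space (M_h h CARD('r)) p" "v \<in> tangent_space (M_h h CARD('r)) p"
    and V: "V \<in> frames (snd p)" "V2 \<in> frames (snd p)"
  shows "frame_transport \<omega> R_H T_H V2 p v' v = frame_transport \<omega> R_H T_H V p v' v"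
proof -
  obtain Q where Q: "orthogonal_matrix Q" "V2 = V ** Q" using frames_related[OF V] .
  note coords = point_coords(1)[OF p(1) V(1)] tangent_coords(1)[OF p(1) V(1) p(2)]
    tangent_coords(1)[OF p(1) V(1) p(3)]
  have R: "R_H (fst p ** V ** Q) (fst v' ** V ** Q) = R_H (fst p ** V) (fst v' ** V) ** Q"
    using homog Q(1) coords by (auto simp: orth_homogeneous_def tangent_bundle_def)
  have T: "T_H (fst p ** V ** Q) (fst v' ** V ** Q) (fst v ** V ** Q)
      = T_H (fst p ** V) (fst v' ** V) (fst v ** V) ** Q"
    using compat Q(1) coords by (auto simp: compatible_transport_def double_tangent_bundle_def)
  have m: "- (A ** V ** Q) = - (A ** V) ** Q" for A by (simp add: matrix_minus_left)
  show ?thesis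
    unfolding frame_transport_def Let_def Q(2) matrix_mul_assoc m R T
      R_St_mult_orthogonal[OF Q(1)] weighted_T_St_mult_orthogonal[OF \<omega> Q(1)]
    by (rule rep_tangent_mult_orthogonal[OF Q(1)])
qed

text \<open>An arbitrary choice, in general discontinuous; the maps defined with it do not depend on it.\<close>

definition frame_of :: "real^'n^'n \<Rightarrow> real^'r^'n" where
  "frame_of G = (SOME V. V \<in> frames G)"

lemma frame_of: "p \<in> (M_h h CARD('r)) \<Longrightarrow> frame_of (snd p) \<in> frames (snd p)"
proof -
  assume "p \<in> (M_h h CARD('r))"
  then have "snd p \<in> Grassmann (CARD('n) - CARD('r))" by (auto simp: M_h_def)
  moreover have "CARD('r) \<le> CARD('n)" by (rule card_inj_on_le[OF inj]) auto
  ultimately show ?thesis unfolding frame_of_def using frames_nonempty some_in_eq by fastforce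
qed

definition R_M where "R_M p v = frame_retraction R_H (frame_of (snd p)) p v"
definition T_M where "T_M p v' v = frame_transport \<omega> R_H T_H (frame_of (snd p)) p v' v"

lemma R_M_frame:
  "p \<in> (M_h h CARD('r)) \<Longrightarrow> v \<in> tangent_space (M_h h CARD('r)) p \<Longrightarrow> V \<in> frames (snd p) \<Longrightarrow> R_M p v = frame_retraction R_H V p v"
  unfolding R_M_def by (rule frame_retraction_indep[OF _ _ _ frame_of])

lemma T_M_frame:
  "p \<in> (M_h h CARD('r)) \<Longrightarrow> v' \<in> tangent_space (M_h h CARD('r)) p \<Longrightarrow> v \<in> tangent_space (M_h h CARD('r)) p \<Longrightarrow> V \<in> frames (snd p) \<Longrightarrow>
    T_M p v' v = frame_transport \<omega> R_H T_H V p v' v"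
  unfolding T_M_def by (rule frame_transport_indep[OF _ _ _ _ frame_of])

text \<open>With a smooth choice of frame all coordinates are smooth and lie in the bundle on which the given
  transport is smooth; the other ingredients are matrix operations.\<close>

lemma smooth_frame_expressions:
  assumes fV: "smooth_map_on S fV" and fp: "smooth_map_on S fp" and fv': "smooth_map_on S fv'"
    and fv: "smooth_map_on S fv"
    and S: "\<And>z. z \<in> S \<Longrightarrow> (fp z, fv' z, fv z) \<in> double_tangent_bundle (M_h h CARD('r)) \<and> fV z \<in> frames (snd (fp z))"
  shows "smooth_map_on S (\<lambda>z. (frame_retraction R_H (fV z) (fp z) (fv' z),
    frame_transport \<omega> R_H T_H (fV z) (fp z) (fv' z) (fv z)))"
proof -
  let ?H = "\<lambda>z. fst (fp z) ** fV z" and ?K' = "\<lambda>z. fst (fv' z) ** fV z" and ?K = "\<lambda>z. fst (fv z) ** fV z"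
  let ?RT = "\<lambda>(x, \<xi>', \<xi>). (R_H x \<xi>', T_H x \<xi>' \<xi>)"
  have coords: "(?H z, ?K' z, ?K z) \<in> double_tangent_bundle Hr" if "z \<in> S" for z
    using S[OF that] point_coords(1)[of "fp z" "fV z"] tangent_coords(1)[of "fp z" "fV z" "fv' z"]
      tangent_coords(1)[of "fp z" "fV z" "fv z"]
    by (auto simp: double_tangent_bundle_def)
  have sm: "smooth_map_on S (\<lambda>z. (?H z, ?K' z, ?K z))"
    by (intro smooth_intros fV fp fv' fv)
  have "smooth_map_on (double_tangent_bundle Hr) ?RT"
    using vt by (simp add: is_vector_transport_def)
  from smooth_map_on_compose[OF sm this] coords
  have "smooth_map_on S (\<lambda>z. (R_H (?H z) (?K' z), T_H (?H z) (?K' z) (?K z)))"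
    by (auto simp: image_subset_iff)
  from smooth_map_on_fst[OF this] smooth_map_on_snd[OF this]
  have R: "smooth_map_on S (\<lambda>z. R_H (?H z) (?K' z))"
    and T: "smooth_map_on S (\<lambda>z. T_H (?H z) (?K' z) (?K z))" by simp_all
  have H: "smooth_map_on S ?H" by (intro smooth_intros fV fp)
  note sqrtH = smooth_map_on_sqrt_M_mat[OF \<omega> H] and sqrtH' = smooth_map_on_sqrt_M_mat[OF \<omega> R]
  have inv: "invertible (matrix_sqrt (M_mat \<omega> X))" for X :: "real^'r^'m"
    by (rule posdef_imp_invertible[OF sqrt_M_mat(2)[OF \<omega>]])
  have "smooth_map_on S (\<lambda>z. frame_retraction R_H (fV z) (fp z) (fv' z))"
    unfolding frame_retraction_def rep_point_def R_St_def
    by (intro smooth_intros R fV fv')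
  moreover have "smooth_map_on S (\<lambda>z. frame_transport \<omega> R_H T_H (fV z) (fp z) (fv' z) (fv z))"
    unfolding frame_transport_def rep_tangent_def R_St_def T_St_def weighted_T_St_def Let_def
    by (intro smooth_intros R T fV fp fv' fv sqrtH sqrtH' inv)
  ultimately show ?thesis by (rule smooth_map_on_Pair)
qed

text \<open>Near \<open>z0\<close> the chosen frames may be replaced by the polar frame based at the frame of \<open>z0\<close>.\<close>

lemma smooth_R_M_T_M:
  "smooth_map_on (double_tangent_bundle (M_h h CARD('r))) (\<lambda>(p, v', v). (R_M p v', T_M p v' v))"
proof (rule smooth_map_on_local)
  fix z0 assume z0: "z0 \<in> double_tangent_bundle (M_h h CARD('r))"
  define V0 where "V0 = frame_of (snd (fst z0))"
  have p0: "fst z0 \<in> (M_h h CARD('r))" using z0 by (auto simp: double_tangent_bundle_def)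
  let ?g = "\<lambda>z :: ((real^'n^'m) \<times> (real^'n^'n)) \<times> ((real^'n^'m) \<times> (real^'n^'n)) \<times> ((real^'n^'m) \<times> (real^'n^'n)).
    gram V0 (snd (fst z))"
  define W where "W = ?g -` {A. posdef A}"
  have "smooth_map_on UNIV ?g" unfolding gram_def by (intro smooth_intros)
  then have W: "open W"
    unfolding W_def by (intro open_vimage open_posdef smooth_map_on_imp_continuous_on)
  have z0W: "z0 \<in> W"
    using gram_base[OF frame_of[OF p0]] by (simp add: W_def V0_def posdef_mat_1)
  let ?S = "double_tangent_bundle (M_h h CARD('r)) \<inter> W"
  let ?V = "\<lambda>z. polar_frame V0 (snd (fst z))"
  have gr: "snd (fst z) \<in> Grassmann (CARD('n) - CARD('r))" and pd: "posdef (gram V0 (snd (fst z)))" if "z \<in> ?S" for z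
    using that by (auto simp: double_tangent_bundle_def M_h_def W_def)
  have V: "?V z \<in> frames (snd (fst z))" if "z \<in> ?S" for z
    by (rule polar_frame(1)[OF gr[OF that] pd[OF that]])
  have sV: "smooth_map_on ?S ?V"
    by (intro smooth_map_on_polar_frame smooth_intros gr pd)
  have "smooth_map_on ?S fst" "smooth_map_on ?S (\<lambda>z. fst (snd z))" "smooth_map_on ?S (\<lambda>z. snd (snd z))"
    by (intro smooth_intros)+
  from smooth_frame_expressions[OF sV this]
  have "smooth_map_on ?S (\<lambda>z. (frame_retraction R_H (?V z) (fst z) (fst (snd z)),
      frame_transport \<omega> R_H T_H (?V z) (fst z) (fst (snd z)) (snd (snd z))))"
    using V by simp
  then have "smooth_map_on ?S (\<lambda>(p, v', v). (R_M p v', T_M p v' v))"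
  proof (rule smooth_map_on_cong)
    fix z assume z: "z \<in> ?S"
    obtain p v' v where zz: "z = (p, v', v)" by (cases z)
    have "p \<in> (M_h h CARD('r))" "v' \<in> tangent_space (M_h h CARD('r)) p" "v \<in> tangent_space (M_h h CARD('r)) p"
      using z zz by (auto simp: double_tangent_bundle_def)
    then show "(frame_retraction R_H (?V z) (fst z) (fst (snd z)),
      frame_transport \<omega> R_H T_H (?V z) (fst z) (fst (snd z)) (snd (snd z))) = (case z of (p, v', v) \<Rightarrow> (R_M p v', T_M p v' v))"
      using V[OF z] R_M_frame T_M_frame by (simp add: zz)
  qed
  then show "\<exists>W. open W \<and> z0 \<in> W \<and>
      smooth_map_on (double_tangent_bundle (M_h h CARD('r)) \<inter> W) (\<lambda>(p, v', v). (R_M p v', T_M p v' v))"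
    using W z0W by blast
qed

lemma R_M_in_M_h:
  assumes p: "p \<in> (M_h h CARD('r))" "v \<in> tangent_space (M_h h CARD('r)) p"
  shows "R_M p v \<in> (M_h h CARD('r))"
proof -
  note V = frame_of[OF p(1)]
  show ?thesis
    unfolding R_M_def frame_retraction_def
    by (intro rep_point_in_M_h[OF inj inv] R_H(1) point_coords[OF p(1) V] tangent_coords[OF p(1) V p(2)]
        R_St_in_Stiefel framesD(1)[OF V])
qed

lemma R_M_zero:
  assumes p: "p \<in> (M_h h CARD('r))" shows "R_M p 0 = p"
proof -
  note V = frame_of[OF p] and 0 = zero_in_tangent_space[OF p]
  show ?thesis
    using R_H(2)[OF point_coords(1)[OF p V] tangent_coords(1)[OF p V 0]] point_coords(2)[OF p V]
    by (simp add: R_M_def frame_retraction_def R_St_def cayley_Pi_0)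
qed

lemma R_M_has_vector_derivative:
  assumes p: "p \<in> (M_h h CARD('r))" "v \<in> tangent_space (M_h h CARD('r)) p"
  shows "((\<lambda>t. R_M p (t *\<^sub>R v)) has_vector_derivative v) (at 0)"
proof -
  define V where "V = frame_of (snd p)"
  have V: "V \<in> frames (snd p)" unfolding V_def by (rule frame_of[OF p(1)])
  let ?H = "fst p ** V" and ?K = "fst v ** V" and ?Vp = "- (snd v ** V)"
  note H = point_coords[OF p(1) V] and K = tangent_coords[OF p(1) V p(2)]
  have "((\<lambda>t. rep_point (R_H ?H (t *\<^sub>R ?K)) (R_St V (t *\<^sub>R ?Vp))) has_vector_derivative
      rep_tangent (R_H ?H (0 *\<^sub>R ?K)) (R_St V (0 *\<^sub>R ?Vp)) ?K ?Vp) (at 0)"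
    by (intro rep_point_has_vector_derivative R_H(3) R_St_has_vector_derivative framesD(1)[OF V] H K)
  then show ?thesis
    using R_H(2)[OF H(1) K(1)] K(3)
    by (simp add: R_M_def frame_retraction_def V_def[symmetric] matrix_distribs R_St_def cayley_Pi_0)
qed

lemma T_M_in_tangent_space:
  assumes p: "p \<in> (M_h h CARD('r))" "v' \<in> tangent_space (M_h h CARD('r)) p" "v \<in> tangent_space (M_h h CARD('r)) p"
  shows "T_M p v' v \<in> tangent_space (M_h h CARD('r)) (R_M p v')"
proof -
  note V = frame_of[OF p(1)]
  show ?thesis
    unfolding T_M_def R_M_def frame_retraction_def frame_transport_def Let_def
    by (intro rep_tangent_in_tangent_space[OF inj inv] R_St_in_Stiefel framesD(1)[OF V]
        weighted_T_St_normal T_H(1) point_coords(1)[OF p(1) V] tangent_coords[OF p(1) V p(2)]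
        tangent_coords[OF p(1) V p(3)])
qed

lemma T_M_zero:
  assumes p: "p \<in> (M_h h CARD('r))" "v \<in> tangent_space (M_h h CARD('r)) p"
  shows "T_M p 0 v = v"
proof -
  define V where "V = frame_of (snd p)"
  have V: "V \<in> frames (snd p)" unfolding V_def by (rule frame_of[OF p(1)])
  note H = point_coords[OF p(1) V] and K = tangent_coords[OF p(1) V p(2)]
  let ?S = "matrix_sqrt (M_mat \<omega> (fst p ** V))"
  have "A ** ?S ** matrix_inv ?S = A" for A :: "real^'r^'n"
    using matrix_inv_mult(1)[OF posdef_imp_invertible[OF sqrt_M_mat(2)[OF \<omega>]], of "fst p ** V"]
    by (simp add: matrix_mul_assoc[symmetric])
  then show ?thesis
    using R_H(2)[OF H(1) K(1)] T_H(2)[OF H(1) K(1) K(1)] K(3)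
    by (simp add: T_M_def frame_transport_def V_def[symmetric] weighted_T_St_def R_St_def T_St_def cayley_Pi_0)
qed

lemma T_M_linear:
  assumes p: "p \<in> (M_h h CARD('r))" "v' \<in> tangent_space (M_h h CARD('r)) p" "v \<in> tangent_space (M_h h CARD('r)) p" "u \<in> tangent_space (M_h h CARD('r)) p"
  shows "T_M p v' (a *\<^sub>R v + b *\<^sub>R u) = a *\<^sub>R T_M p v' v + b *\<^sub>R T_M p v' u"
proof -
  define V where "V = frame_of (snd p)"
  have V: "V \<in> frames (snd p)" unfolding V_def by (rule frame_of[OF p(1)])
  have 1: "fst (a *\<^sub>R v + b *\<^sub>R u) ** V = a *\<^sub>R (fst v ** V) + b *\<^sub>R (fst u ** V)"
    by (simp add: matrix_distribs)
  have 2: "- (snd (a *\<^sub>R v + b *\<^sub>R u) ** V) = a *\<^sub>R (- (snd v ** V)) + b *\<^sub>R (- (snd u ** V))"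
    by (simp add: matrix_distribs)
  show ?thesis
    unfolding T_M_def frame_transport_def V_def[symmetric] Let_def 1 2 weighted_T_St_linear
      T_H_linear[OF point_coords(1)[OF p(1) V] tangent_coords(1)[OF p(1) V p(2)]
        tangent_coords(1)[OF p(1) V p(3)] tangent_coords(1)[OF p(1) V p(4)]]
    by (rule rep_tangent_linear)
qed

lemma T_M_isometric:
  assumes p: "p \<in> (M_h h CARD('r))" "v' \<in> tangent_space (M_h h CARD('r)) p" "v \<in> tangent_space (M_h h CARD('r)) p"
  shows "metric_M_h \<omega> (T_M p v' v) (T_M p v' v) = metric_M_h \<omega> v v"
proof -
  define V where "V = frame_of (snd p)"
  have V: "V \<in> frames (snd p)" unfolding V_def by (rule frame_of[OF p(1)])
  note St = framesD(1)[OF V]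
  note H = point_coords(1)[OF p(1) V] and K' = tangent_coords[OF p(1) V p(2)]
    and K = tangent_coords[OF p(1) V p(3)]
  let ?H = "fst p ** V" and ?K' = "fst v' ** V" and ?K = "fst v ** V"
    and ?Vp' = "- (snd v' ** V)" and ?Vp = "- (snd v ** V)"
  let ?P = "cayley_Pi V ?Vp'" and ?A = "?Vp ** matrix_sqrt (M_mat \<omega> ?H)"
  have "metric_M_h \<omega> (T_M p v' v) (T_M p v' v)
      = T_H ?H ?K' ?K \<bullet> T_H ?H ?K' ?K + (?P ** ?A) \<bullet> (?P ** ?A)"
    unfolding T_M_def frame_transport_def V_def[symmetric] Let_def
    by (subst metric_rep_tangent[OF \<omega> R_St_in_Stiefel[OF St] weighted_T_St_normal[OF K(2)]])
      (simp only: weighted_T_St_sqrt[OF \<omega>])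
  also have "(?P ** ?A) \<bullet> (?P ** ?A) = ?A \<bullet> (transpose ?P ** ?P ** ?A)"
    by (simp only: inner_mult_adjoint_left[of ?P] matrix_mul_assoc[symmetric])
  also have "\<dots> = ?A \<bullet> ?A" by (simp add: cayley_Pi_orthogonal)
  also have "T_H ?H ?K' ?K \<bullet> T_H ?H ?K' ?K = ?K \<bullet> ?K"
    by (rule T_H(3)[OF H K'(1) K(1)])
  also have "?K \<bullet> ?K + ?A \<bullet> ?A = metric_M_h \<omega> v v"
    using metric_rep_tangent[OF \<omega> St K(2), of ?H ?K] by (simp only: K(3))
  finally show ?thesis .
qed

lemma is_retraction_R_M: "is_retraction (M_h h CARD('r)) R_M"
proof -
  \<comment> \<open>Smoothness is that of the first component of retraction and transport, taken at the zero vector.\<close>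
  have 1: "smooth_map_on (tangent_bundle (M_h h CARD('r))) (\<lambda>z. (fst z, snd z, 0 :: (real^'n^'m) \<times> (real^'n^'n)))"
    by (intro smooth_intros)
  have "smooth_map_on (tangent_bundle (M_h h CARD('r))) (\<lambda>z. case (fst z, snd z, 0) of (p, v', v) \<Rightarrow> (R_M p v', T_M p v' v))"
    by (rule smooth_map_on_compose[OF 1 smooth_R_M_T_M])
      (auto simp: tangent_bundle_def double_tangent_bundle_def zero_in_tangent_space)
  from smooth_map_on_fst[OF this] have "smooth_map_on (tangent_bundle (M_h h CARD('r))) (\<lambda>(p, v). R_M p v)"
    by (simp add: case_prod_unfold)
  then show ?thesis
    by (auto simp: is_retraction_def tangent_bundle_def R_M_in_M_h R_M_zero R_M_has_vector_derivative)
qed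

lemma is_isometric_vector_transport_T_M:
  "is_isometric_vector_transport (metric_M_h \<omega>) (M_h h CARD('r)) R_M T_M"
  unfolding is_isometric_vector_transport_def is_vector_transport_def
  using is_retraction_R_M smooth_R_M_T_M
  by (auto simp: tangent_bundle_def double_tangent_bundle_def T_M_in_tangent_space T_M_zero
      T_M_isometric intro: T_M_linear)

lemma transport_representation:
  assumes tangents: "(p, v', v) \<in> double_tangent_bundle (M_h h CARD('r))" and p: "represents_point h \<iota> H V p"
    and v': "represents_tangent h \<iota> H V K' Vp' v'" and v: "represents_tangent h \<iota> H V K Vp v"
  shows "represents_point h \<iota> (R_H H K') (R_St V Vp') (R_M p v')"
    and "represents_tangent h \<iota> (R_H H K') (R_St V Vp') (T_H H K' K)
      (weighted_T_St \<omega> H (R_H H K') V Vp' Vp) (T_M p v' v)"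
proof -
  have mem: "p \<in> (M_h h CARD('r))" "v' \<in> tangent_space (M_h h CARD('r)) p" "v \<in> tangent_space (M_h h CARD('r)) p"
    using tangents by (auto simp: double_tangent_bundle_def)
  have H: "H \<in> Hr" and V: "V \<in> Stiefel" and p_eq: "p = rep_point H V"
    using p by (auto simp: represents_point_def rep_point_def)
  have K': "K' \<in> tangent_space Hr H" "transpose V ** Vp' = 0" "v' = rep_tangent H V K' Vp'"
    and K: "K \<in> tangent_space Hr H" "transpose V ** Vp = 0" "v = rep_tangent H V K Vp"
    using v' v by (auto simp: represents_tangent_def rep_tangent_def)
  have frame: "V \<in> frames (snd p)"
    using frames_range[OF V] by (simp add: p_eq rep_point_def)
  have coords: "fst p ** V = H" "fst v' ** V = K'" "- (snd v' ** V) = Vp'" "fst v ** V = K" "- (snd v ** V) = Vp"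
    using rep_tangent_coords[OF V K'(2)] rep_tangent_coords[OF V K(2)]
    by (simp_all add: p_eq K'(3) K(3) rep_point_def Stiefel_cancel[OF V])
  have R: "R_M p v' = rep_point (R_H H K') (R_St V Vp')"
    using R_M_frame[OF mem(1,2) frame] by (simp only: frame_retraction_def coords)
  have T: "T_M p v' v = rep_tangent (R_H H K') (R_St V Vp') (T_H H K' K) (weighted_T_St \<omega> H (R_H H K') V Vp' Vp)"
    using T_M_frame[OF mem frame] by (simp only: frame_transport_def coords Let_def)
  show "represents_point h \<iota> (R_H H K') (R_St V Vp') (R_M p v')"
    unfolding represents_point_def R
    using R_H(1)[OF H K'(1)] R_St_in_Stiefel[OF V] by (simp add: rep_point_def)
  show "represents_tangent h \<iota> (R_H H K') (R_St V Vp') (T_H H K' K)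
      (weighted_T_St \<omega> H (R_H H K') V Vp' Vp) (T_M p v' v)"
    unfolding represents_tangent_def T
    using T_H(1)[OF H K'(1) K(1)] weighted_T_St_normal[OF K(2)] by (simp add: rep_tangent_def)
qed

end

theorem proposition14:
  fixes h :: "real^'n^'m \<Rightarrow> real^'q"
    and \<iota> :: "'r::finite \<Rightarrow> 'n"
    and \<omega> :: real
    and R_H :: "real^'r^'m \<Rightarrow> real^'r^'m \<Rightarrow> real^'r^'m"
    and T_H :: "real^'r^'m \<Rightarrow> real^'r^'m \<Rightarrow> real^'r^'m \<Rightarrow> real^'r^'m"
  assumes "CARD('r) \<le> min CARD('m) CARD('n)"
    and "inj \<iota>"
    and "smooth_on_open h UNIV"
    and "orth_invariant h"
    and "full_rank_on_zeros h"
    and "0 < \<omega>"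
    and "is_isometric_vector_transport (\<bullet>) (H_r h \<iota>) R_H T_H"
    and "orth_homogeneous (H_r h \<iota>) R_H"
    and "compatible_transport (H_r h \<iota>) T_H"
  shows "\<exists>R T.
    is_isometric_vector_transport (metric_M_h \<omega>) (M_h h CARD('r)) R T \<and>
    (\<forall>p v' v H V K' Vp' K Vp.
       (p, v', v) \<in> double_tangent_bundle (M_h h CARD('r)) \<and>
       represents_point h \<iota> H V p \<and>
       represents_tangent h \<iota> H V K' Vp' v' \<and>
       represents_tangent h \<iota> H V K Vp v \<longrightarrow>
       (let H' = R_H H K';
            V' = R_St V Vp';
            K_bar = T_H H K' K;
            Vp_bar = T_St V Vp' (Vp ** matrix_sqrt (M_mat \<omega> H))
                       ** matrix_inv (matrix_sqrt (M_mat \<omega> H'))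
        in represents_point h \<iota> H' V' (R p v') \<and>
           represents_tangent h \<iota> H' V' K_bar Vp_bar (T p v' v)))"
proof -
  interpret compatible_pair h \<iota> \<omega> R_H T_H
    by unfold_locales (use assms in auto)
  show ?thesis
    using is_isometric_vector_transport_T_M transport_representation[unfolded weighted_T_St_def]
    by (intro exI[of _ R_M] exI[of _ T_M]) (auto simp: Let_def)
qed

end
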